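(* Consider the port-Hamiltonian system \begin{align*} \frac{\partial x}{\partial t}(\zeta,t) &= \left(P_1\frac{\partial}{\partial\zeta}+G_0\right)(\mathcal H(\zeta)x(\zeta,t)),\qquad x(\zeta,0)=x_0(\zeta),\\ 0&=\begin{bmatrix}W_{B,1}&W_{B,0}\end{bmatrix}\begin{bmatrix}(\mathcal Hx)(1,t)\\(\mathcal Hx)(0,t)\end{bmatrix},\qquad y(t)=\begin{bmatrix}W_{C,1}&W_{C,0}\end{bmatrix}\begin{bmatrix}(\mathcal Hx)(1,t)\\(\mathcal Hx)(0,t)\end{bmatrix}, \end{align*} with $\zeta\in[0,1]$, $t\ge 0$, satisfying the standing assumptions listed in the context, and let $A$ and $C$ be its associated operators. Suppose that the $2n\times 2n$ matrix $$\mathcal W_{BC}:=\begin{bmatrix}W_{B,1}&W_{B,0}\\ W_{C,1}&W_{C,0}\end{bmatrix}$$ is invertible and that the $C_0$-semigroup generated by $A$ is exponentially stable. Suppose further that the $C_0$-semigroup generated by $A-(\mathrm{Re}\,G_0)\mathcal H$ (with domain $\mathbf D(A)$) is strongly stable. Then the system satisfies the Hautus test: there exists a constant $m>0$ such that for every $s\in\mathbb C$ with $\mathrm{Re}\,s<0$ and every $x\in\mathbf D(A)$ $$\|(sI-A)x\|_X^2+|\mathrm{Re}\,s|\,\|Cx\|^2\ \ge\ m\,|\mathrm{Re}\,s|^2\,\|x\|_X^2 ;$$ and thus the system is approximately observable, i.e. $\int_0^\infty\|CT(t)x_0\|^2\,dt>0$ for all $x_0\in\mathbf D(A)$ with $x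_0\ne0$.
   Context: Standing assumptions: $P_1$ is an invertible Hermitian $n\times n$ matrix; $G_0$ is a (complex) $n\times n$ matrix; $\begin{bmatrix}W_{B,1}&W_{B,0}\end{bmatrix}$ and $\begin{bmatrix}W_{C,1}&W_{C,0}\end{bmatrix}$ are $n\times 2n$ matrices of full row rank; $\mathcal H(\zeta)$ is a positive Hermitian $n\times n$ matrix for almost all $\zeta\in[0,1]$ with $\mathcal H,\mathcal H^{-1}\in L^\infty(0,1;\mathbb C^{n\times n})$. Write $P_1\mathcal H(\zeta)=S^{-1}(\zeta)\Delta(\zeta)S(\zeta)$ with $\Delta(\zeta)$ diagonal and $S(\zeta)$ invertible for almost all $\zeta$; it is assumed that $S^{-1},S,\Delta:[0,1]\to\mathbb C^{n\times n}$ are continuously differentiable. The state space is $X:=L^2(0,1;\mathbb C^n)$ with the energy norm $\|x\|_X=\sqrt{\langle x,\mathcal Hx\rangle}$, where $\langle\cdot,\cdot\rangle$ is the standard $L^2$ inner product; this norm is equivalent to the standard $L^2$ norm. The operator $A:\mathbf D(A)\subset X\to X$ is $Ax:=\left(P_1\frac{d}{d\zeta}+G_0\right)(\mathcal Hx)$ with $$\mathbf D(A):=\left\{x\in X\ \middle|\ \mathcal Hx\in H^1(0,1;\mathbb C^n),\ \begin{bmatrix}W_{B,1}&W_{B,0}\end{bmatrix}\begin{bmatrix}(\mathcal Hx)(1)\\(\mathcal Hx)(0)\end{bmatrix}=0\right\}.$$ It is assumed that $A$ generates a $C_0$-semigroup $(T(t))_{t\ge0}$ on $X$. The output operator $C:\mathbf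 D(A)\to\mathbb C^n$ is $Cx:=\begin{bmatrix}W_{C,1}&W_{C,0}\end{bmatrix}\begin{bmatrix}(\mathcal Hx)(1)\\(\mathcal Hx)(0)\end{bmatrix}$, so that for $x_0\in\mathbf D(A)$ the classical solution is $x(\cdot,t)=T(t)x_0$ and $y(t)=CT(t)x_0$. $\mathrm{Re}\,G_0:=\frac12(G_0+G_0^* )$, and $(\mathrm{Re}\,G_0)\mathcal H$ denotes the bounded multiplication operator $x\mapsto(\mathrm{Re}\,G_0)\mathcal H(\cdot)x(\cdot)$ on $X$. A $C_0$-semigroup $(T(t))_{t\ge0}$ on $X$ is exponentially stable if there are $M\ge1$, $\omega>0$ with $\|T(t)\|\le Me^{-\omega t}$ for all $t\ge0$, and strongly stable if $\lim_{t\to\infty}\|T(t)x\|=0$ for all $x\in X$. *)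

theory Defs
  imports "HOL-Analysis.Analysis"
begin

section \<open>Complex matrices\<close>

definition ctranspose :: "complex^'n^'m \<Rightarrow> complex^'m^'n" where
  "ctranspose A = (\<chi> i j. cnj (A $ j $ i))"

definition hermitian :: "complex^'n^'n \<Rightarrow> bool" where
  "hermitian A \<longleftrightarrow> ctranspose A = A"

text \<open>For a Hermitian \<open>A\<close> the number \<open>v\<^sup>* A v\<close> is real, so it is equal to the real inner product
  \<open>v \<bullet> (A *v v) = Re (v\<^sup>* A v)\<close>.\<close>

definition positive_hermitian :: "complex^'n^'n \<Rightarrow> bool" where
  "positive_hermitian A \<longleftrightarrow> hermitian A \<and> (\<forall>v. v \<noteq> 0 \<longrightarrow> v \<bullet> (A *v v) > 0)"

definition diagonal_matrix :: "complex^'n^'n \<Rightarrow> bool" where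
  "diagonal_matrix A \<longleftrightarrow> (\<forall>i j. i \<noteq> j \<longrightarrow> A $ i $ j = 0)"

definition re_part :: "complex^'n^'n \<Rightarrow> complex^'n^'n" where
  "re_part A = (1/2) *\<^sub>R (A + ctranspose A)"

text \<open>\<open>vstack u v\<close> is the column \<open>[u; v]\<close>; applied to matrices, which are columns of rows,
  it puts one block on top of the other. \<open>hblock M N\<close> is the block row \<open>[M N]\<close>.\<close>

definition vstack :: "'a^'n \<Rightarrow> 'a^'m \<Rightarrow> 'a^('n + 'm)" where
  "vstack u v = (\<chi> k. case k of Inl i \<Rightarrow> u $ i | Inr j \<Rightarrow> v $ j)"

definition hblock :: "'a^'n^'k \<Rightarrow> 'a^'m^'k \<Rightarrow> 'a^('n + 'm)^'k" where
  "hblock M N = (\<chi> i. vstack (M $ i) (N $ i))"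

text \<open>The library's \<open>C1_differentiable_on\<close> uses two-sided derivatives, which at the end points
  of an interval would involve values outside of it.\<close>

definition C1_on_interval :: "real \<Rightarrow> real \<Rightarrow> (real \<Rightarrow> 'a::real_normed_vector) \<Rightarrow> bool" where
  "C1_on_interval a b f \<longleftrightarrow>
     (\<exists>f'. (\<forall>t\<in>{a..b}. (f has_vector_derivative f' t) (at t within {a..b}))
         \<and> continuous_on {a..b} f')"

section \<open>The Hilbert space of square integrable functions on the unit interval\<close>

abbreviation unit_lebesgue :: "real measure" where
  "unit_lebesgue \<equiv> lebesgue_on {0..1}"

definition square_integrable :: "(real \<Rightarrow> 'a::euclidean_space) \<Rightarrow> bool" where
  "square_integrable f \<longleftrightarrow>
     f \<in> borel_measurable unit_lebesgue \<and> integrable unit_lebesgue (\<lambda>t. (norm (f t))\<^sup>2)"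

lemma square_integrable_inner:
  assumes "square_integrable f" "square_integrable g"
  shows "integrable unit_lebesgue (\<lambda>t. f t \<bullet> g t)"
proof (rule Bochner_Integration.integrable_bound)
  show "integrable unit_lebesgue (\<lambda>t. (norm (f t))\<^sup>2 + (norm (g t))\<^sup>2)"
    using assms by (simp add: square_integrable_def)
  show "(\<lambda>t. f t \<bullet> g t) \<in> borel_measurable unit_lebesgue"
    using assms by (auto simp: square_integrable_def)
  have "norm (f t \<bullet> g t) \<le> norm ((norm (f t))\<^sup>2 + (norm (g t))\<^sup>2)" for t
  proof -
    have "\<bar>f t \<bullet> g t\<bar> \<le> norm (f t) * norm (g t)"
      by (rule Cauchy_Schwarz_ineq2)
    moreover have "2 * (norm (f t) * norm (g t)) \<le> (norm (f t))\<^sup>2 + (norm (g t))\<^sup>2"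
      using sum_squares_bound[of "norm (f t)" "norm (g t)"] by simp
    moreover have "0 \<le> norm (f t) * norm (g t)" by simp
    ultimately have "\<bar>f t \<bullet> g t\<bar> \<le> (norm (f t))\<^sup>2 + (norm (g t))\<^sup>2" by linarith
    then show ?thesis by simp
  qed
  then show "AE t in unit_lebesgue.
      norm (f t \<bullet> g t) \<le> norm ((norm (f t))\<^sup>2 + (norm (g t))\<^sup>2)" by simp
qed

lemma square_integrable_zero: "square_integrable (\<lambda>t. 0)"
  by (simp add: square_integrable_def)

lemma square_integrable_add:
  assumes f: "square_integrable f" and g: "square_integrable g"
  shows "square_integrable (\<lambda>t. f t + g t)"
proof -
  have eq: "(norm (f t + g t))\<^sup>2 = (norm (f t))\<^sup>2 + 2 * (f t \<bullet> g t) + (norm (g t))\<^sup>2" for t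
    unfolding power2_norm_eq_inner by (simp add: inner_add inner_commute)
  show ?thesis
    using f g square_integrable_inner[OF f g] unfolding square_integrable_def eq by auto
qed

lemma square_integrable_scaleR:
  assumes "square_integrable f"
  shows "square_integrable (\<lambda>t. r *\<^sub>R f t)"
  using assms by (auto simp: square_integrable_def power_mult_distrib)

lemma square_integrable_diff:
  assumes "square_integrable f" and "square_integrable g"
  shows "square_integrable (\<lambda>t. f t - g t)"
  using square_integrable_add[OF assms(1) square_integrable_scaleR[OF assms(2), of "-1"]] by simp

lemma norm_vector_scalar_mult: "norm (c *s (v::complex^'n)) = cmod c * norm v"
  by (simp add: norm_vec_def norm_mult L2_set_right_distrib)

lemma square_integrable_cscale:
  fixes f :: "real \<Rightarrow> complex^'n"
  assumes "square_integrable f"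
  shows "square_integrable (\<lambda>t. c *s f t)"
proof -
  have "bounded_linear (\<lambda>v::complex^'n. c *s v)"
    by (rule bounded_linear_intro[where K="cmod c"])
       (simp_all add: vec_eq_iff algebra_simps norm_vector_scalar_mult)
  then have "(\<lambda>v::complex^'n. c *s v) \<in> borel_measurable borel"
    by (intro borel_measurable_continuous_onI linear_continuous_on)
  then have "(\<lambda>t. c *s f t) \<in> borel_measurable unit_lebesgue"
    using assms measurable_compose by (fastforce simp: square_integrable_def)
  then show ?thesis
    using assms by (simp add: square_integrable_def norm_vector_scalar_mult power_mult_distrib)
qed

definition L2_rel :: "(real \<Rightarrow> 'a::euclidean_space) \<Rightarrow> (real \<Rightarrow> 'a) \<Rightarrow> bool" where
  "L2_rel f g \<longleftrightarrow>
     square_integrable f \<and> square_integrable g \<and> (AE t in unit_lebesgue. f t = g t)"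

lemma part_equivp_L2_rel: "part_equivp (L2_rel :: (real \<Rightarrow> 'a::euclidean_space) \<Rightarrow> _)"
proof (rule part_equivpI)
  show "\<exists>f. L2_rel f (f :: real \<Rightarrow> 'a)"
    using square_integrable_zero by (auto simp: L2_rel_def)
  show "symp (L2_rel :: (real \<Rightarrow> 'a) \<Rightarrow> _)"
    by (auto simp: symp_def L2_rel_def elim: eventually_mono)
  show "transp (L2_rel :: (real \<Rightarrow> 'a) \<Rightarrow> _)"
    by (auto simp: transp_def L2_rel_def elim: eventually_elim2)
qed

quotient_type (overloaded) 'a L2 = "real \<Rightarrow> 'a::euclidean_space" / partial: "L2_rel"
  by (rule part_equivp_L2_rel)

instantiation L2 :: (euclidean_space) real_vector
begin

lift_definition zero_L2 :: "'a L2" is "\<lambda>t. 0"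
  using square_integrable_zero by (auto simp: L2_rel_def)

lift_definition plus_L2 :: "'a L2 \<Rightarrow> 'a L2 \<Rightarrow> 'a L2" is "\<lambda>f g t. f t + g t"
  by (auto simp: L2_rel_def intro: square_integrable_add elim: eventually_elim2)

lift_definition scaleR_L2 :: "real \<Rightarrow> 'a L2 \<Rightarrow> 'a L2" is "\<lambda>r f t. r *\<^sub>R f t"
  by (auto simp: L2_rel_def intro: square_integrable_scaleR elim: eventually_mono)

lift_definition uminus_L2 :: "'a L2 \<Rightarrow> 'a L2" is "\<lambda>f t. - f t"
  by (auto simp: L2_rel_def square_integrable_def elim: eventually_mono)

lift_definition minus_L2 :: "'a L2 \<Rightarrow> 'a L2 \<Rightarrow> 'a L2" is "\<lambda>f g t. f t - g t"
  by (auto simp: L2_rel_def intro: square_integrable_diff elim: eventually_elim2)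

instance
proof
  fix x y z :: "'a L2" and r s :: real
  show "x + y + z = x + (y + z)"
    by transfer (auto simp: L2_rel_def add.assoc intro!: square_integrable_add)
  show "x + y = y + x"
    by transfer (auto simp: L2_rel_def add.commute intro!: square_integrable_add)
  show "0 + x = x"
    by transfer (auto simp: L2_rel_def)
  show "- x + x = 0"
    by transfer (auto simp: L2_rel_def square_integrable_zero)
  show "x - y = x + - y"
    by transfer (auto simp: L2_rel_def intro: square_integrable_diff)
  show "r *\<^sub>R (x + y) = r *\<^sub>R x + r *\<^sub>R y"
    by transfer (auto simp: L2_rel_def scaleR_add_right
        intro!: square_integrable_add square_integrable_scaleR)
  show "(r + s) *\<^sub>R x = r *\<^sub>R x + s *\<^sub>R x"
    by transfer (auto simp: L2_rel_def scaleR_add_left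
        intro!: square_integrable_add square_integrable_scaleR)
  show "r *\<^sub>R s *\<^sub>R x = (r * s) *\<^sub>R x"
    by transfer (auto simp: L2_rel_def intro!: square_integrable_scaleR)
  show "1 *\<^sub>R x = x"
    by transfer (auto simp: L2_rel_def)
qed

end

instantiation L2 :: (euclidean_space) real_inner
begin

lift_definition inner_L2 :: "'a L2 \<Rightarrow> 'a L2 \<Rightarrow> real" is
  "\<lambda>f g. integral\<^sup>L unit_lebesgue (\<lambda>t. f t \<bullet> g t)"
  by (rule integral_cong_AE)
     (auto simp: L2_rel_def square_integrable_def elim: eventually_elim2)

definition norm_L2 :: "'a L2 \<Rightarrow> real" where
  "norm_L2 x = sqrt (x \<bullet> x)"

definition sgn_L2 :: "'a L2 \<Rightarrow> 'a L2" where
  "sgn_L2 x = x /\<^sub>R norm x"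

definition dist_L2 :: "'a L2 \<Rightarrow> 'a L2 \<Rightarrow> real" where
  "dist_L2 x y = norm (x - y)"

definition uniformity_L2 :: "('a L2 \<times> 'a L2) filter" where
  "uniformity_L2 = (INF e\<in>{0<..}. principal {(x, y). dist x y < e})"

definition open_L2 :: "'a L2 set \<Rightarrow> bool" where
  "open_L2 U = (\<forall>x\<in>U. eventually (\<lambda>(x', y). x' = x \<longrightarrow> y \<in> U) uniformity)"

instance
proof
  fix x y z :: "'a L2" and r s :: real
  show "dist x y = norm (x - y)"
    by (simp add: dist_L2_def)
  show "sgn x = x /\<^sub>R norm x"
    by (simp add: sgn_L2_def)
  show "uniformity = (INF e\<in>{0<..}. principal {(x, y :: 'a L2). dist x y < e})"
    by (simp add: uniformity_L2_def)
  show "open U = (\<forall>x\<in>U. \<forall>\<^sub>F (x', y) in uniformity. x' = x \<longrightarrow> y \<in> U)" for U :: "'a L2 set"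
    by (simp add: open_L2_def)
  show "x \<bullet> y = y \<bullet> x"
    by transfer (simp add: inner_commute)
  show "(x + y) \<bullet> z = x \<bullet> z + y \<bullet> z"
    by transfer (auto simp: L2_rel_def inner_add_left square_integrable_inner)
  show "(r *\<^sub>R x) \<bullet> y = r * (x \<bullet> y)"
    by transfer (auto simp: L2_rel_def)
  show "0 \<le> x \<bullet> x"
    by transfer (auto intro: integral_nonneg_AE)
  show "x \<bullet> x = 0 \<longleftrightarrow> x = 0"
  proof transfer
    fix f :: "real \<Rightarrow> 'a" assume "L2_rel f f"
    then have f: "square_integrable f" by (simp add: L2_rel_def)
    have "(integral\<^sup>L unit_lebesgue (\<lambda>t. f t \<bullet> f t) = 0) \<longleftrightarrow> (AE t in unit_lebesgue. f t \<bullet> f t = 0)"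
      by (rule integral_nonneg_eq_0_iff_AE) (use square_integrable_inner[OF f f] in auto)
    then show "(integral\<^sup>L unit_lebesgue (\<lambda>t. f t \<bullet> f t) = 0) = L2_rel f (\<lambda>t. 0)"
      using f square_integrable_zero by (auto simp: L2_rel_def)
  qed
  show "norm x = sqrt (x \<bullet> x)"
    by (simp add: norm_L2_def)
qed

end

text \<open>On \<open>(complex^'n) L2\<close> the inner product above is the real part of the complex \<open>L\<^sup>2\<close> inner product;
  both give the same norm. The complex scalar multiplication is separate.\<close>

lift_definition cscale :: "complex \<Rightarrow> (complex^'n) L2 \<Rightarrow> (complex^'n) L2" is "\<lambda>c f t. c *s f t"
  by (auto simp: L2_rel_def intro: square_integrable_cscale elim: eventually_mono)

text \<open>Multiplication by a matrix-valued function. For an essentially bounded measurable \<open>M\<close>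
  the function \<open>t \<mapsto> M(t) x(t)\<close> is again square integrable.\<close>

definition mult_op :: "(real \<Rightarrow> complex^'n^'n) \<Rightarrow> (complex^'n) L2 \<Rightarrow> (complex^'n) L2" where
  "mult_op M x = abs_L2 (\<lambda>t. M t *v rep_L2 x t)"

definition Linfinity :: "(real \<Rightarrow> 'a::euclidean_space) \<Rightarrow> bool" where
  "Linfinity f \<longleftrightarrow>
     f \<in> borel_measurable unit_lebesgue \<and> (\<exists>K. AE t in unit_lebesgue. norm (f t) \<le> K)"

section \<open>The Sobolev space \<open>H\<^sup>1(0,1)\<close>\<close>

text \<open>\<open>H\<^sup>1(0,1)\<close> consists of the classes that have an absolutely continuous representative \<open>u\<close> with
  square integrable derivative \<open>g\<close>, that is, \<open>u\<close> is an indefinite integral of \<open>g\<close>.\<close>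

definition H1_rep :: "'a::euclidean_space L2 \<Rightarrow> (real \<Rightarrow> 'a) \<Rightarrow> 'a L2 \<Rightarrow> bool" where
  "H1_rep f u g \<longleftrightarrow>
     (AE t in unit_lebesgue. rep_L2 f t = u t) \<and>
     (\<forall>t\<in>{0..1}. u t = u 0 + integral\<^sup>L (lebesgue_on {0..t}) (rep_L2 g))"

definition H1 :: "'a::euclidean_space L2 set" where
  "H1 = {f. \<exists>u g. H1_rep f u g}"

text \<open>For \<open>f \<in> H1\<close> the derivative \<open>g\<close> and the values of \<open>u\<close> on the unit interval are unique.\<close>

definition H1_fun :: "'a::euclidean_space L2 \<Rightarrow> real \<Rightarrow> 'a" where
  "H1_fun f = (SOME u. \<exists>g. H1_rep f u g)"

definition H1_deriv :: "'a::euclidean_space L2 \<Rightarrow> 'a L2" where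
  "H1_deriv f = (SOME g. \<exists>u. H1_rep f u g)"

section \<open>Strongly continuous semigroups\<close>

text \<open>Strong continuity, boundedness and generators depend only on the topology, and the energy norm
  below is equivalent to the norm of the type, so they are stated with the latter.
  Only the values \<open>T t\<close> with \<open>t \<ge> 0\<close> matter.\<close>

definition C0_semigroup :: "(real \<Rightarrow> (complex^'n) L2 \<Rightarrow> (complex^'n) L2) \<Rightarrow> bool" where
  "C0_semigroup T \<longleftrightarrow>
     (\<forall>t\<ge>0. bounded_linear (T t) \<and> (\<forall>c x. T t (cscale c x) = cscale c (T t x))) \<and>
     (\<forall>x. T 0 x = x) \<and>
     (\<forall>s\<ge>0. \<forall>t\<ge>0. \<forall>x. T (s + t) x = T s (T t x)) \<and>
     (\<forall>x. ((\<lambda>t. T t x) \<longlongrightarrow> x) (at_right 0))"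

text \<open>\<open>generates D A T\<close>: the operator \<open>A\<close> with domain \<open>D\<close> is the infinitesimal generator of the
  \<open>C\<^sub>0\<close>-semigroup \<open>T\<close>.\<close>

definition generates ::
  "(complex^'n) L2 set \<Rightarrow> ((complex^'n) L2 \<Rightarrow> (complex^'n) L2) \<Rightarrow>
   (real \<Rightarrow> (complex^'n) L2 \<Rightarrow> (complex^'n) L2) \<Rightarrow> bool" where
  "generates D A T \<longleftrightarrow> C0_semigroup T \<and>
     (\<forall>x z. ((\<lambda>t. (1 / t) *\<^sub>R (T t x - x)) \<longlongrightarrow> z) (at_right 0) \<longleftrightarrow> x \<in> D \<and> z = A x)"

section \<open>Port-Hamiltonian operators\<close>

text \<open>As \<open>H\<close> is pointwise Hermitian, \<open>\<langle>x, H x\<rangle>\<close> is real and equal to the real inner product.\<close>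

definition energy_norm :: "(real \<Rightarrow> complex^'n^'n) \<Rightarrow> (complex^'n) L2 \<Rightarrow> real" where
  "energy_norm H x = sqrt (x \<bullet> mult_op H x)"

definition exponentially_stable ::
  "(real \<Rightarrow> complex^'n^'n) \<Rightarrow> (real \<Rightarrow> (complex^'n) L2 \<Rightarrow> (complex^'n) L2) \<Rightarrow> bool" where
  "exponentially_stable H T \<longleftrightarrow>
     (\<exists>M \<omega>. M \<ge> 1 \<and> \<omega> > 0 \<and>
        (\<forall>t\<ge>0. \<forall>x. energy_norm H (T t x) \<le> M * exp (- \<omega> * t) * energy_norm H x))"

definition strongly_stable ::
  "(real \<Rightarrow> complex^'n^'n) \<Rightarrow> (real \<Rightarrow> (complex^'n) L2 \<Rightarrow> (complex^'n) L2) \<Rightarrow> bool" where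
  "strongly_stable H T \<longleftrightarrow> (\<forall>x. ((\<lambda>t. energy_norm H (T t x)) \<longlongrightarrow> 0) at_top)"

text \<open>The column \<open>[(H x)(1); (H x)(0)]\<close>\<close>

definition boundary_values ::
  "(real \<Rightarrow> complex^'n^'n) \<Rightarrow> (complex^'n) L2 \<Rightarrow> complex^('n + 'n)" where
  "boundary_values H x = vstack (H1_fun (mult_op H x) 1) (H1_fun (mult_op H x) 0)"

definition phs_domain ::
  "complex^'n^'n \<Rightarrow> complex^'n^'n \<Rightarrow> (real \<Rightarrow> complex^'n^'n) \<Rightarrow> (complex^'n) L2 set" where
  "phs_domain W\<^sub>B\<^sub>1 W\<^sub>B\<^sub>0 H =
     {x. mult_op H x \<in> H1 \<and> hblock W\<^sub>B\<^sub>1 W\<^sub>B\<^sub>0 *v boundary_values H x = 0}"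

definition phs_operator ::
  "complex^'n^'n \<Rightarrow> complex^'n^'n \<Rightarrow> (real \<Rightarrow> complex^'n^'n) \<Rightarrow>
   (complex^'n) L2 \<Rightarrow> (complex^'n) L2" where
  "phs_operator P\<^sub>1 G\<^sub>0 H x =
     mult_op (\<lambda>_. P\<^sub>1) (H1_deriv (mult_op H x)) + mult_op (\<lambda>_. G\<^sub>0) (mult_op H x)"

definition phs_output ::
  "complex^'n^'n \<Rightarrow> complex^'n^'n \<Rightarrow> (real \<Rightarrow> complex^'n^'n) \<Rightarrow>
   (complex^'n) L2 \<Rightarrow> complex^'n" where
  "phs_output W\<^sub>C\<^sub>1 W\<^sub>C\<^sub>0 H x = hblock W\<^sub>C\<^sub>1 W\<^sub>C\<^sub>0 *v boundary_values H x"

end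

theory Submission
  imports Defs
begin

text \<open>
  Put \<open>u = \<H> x\<close>. By the diagonalisation assumption \<open>\<H>\<close> coincides almost everywhere with a continuously
  differentiable function, and since \<open>\<W>\<^sub>B\<^sub>C\<close> is invertible, \<open>\<parallel>C x\<parallel>\<close> controls both boundary values of \<open>u\<close>
  on the domain of \<open>A\<close>. Two quadratic forms are used.

  The energy satisfies \<open>Re \<langle>\<H> x, A x\<rangle> \<ge> - g \<langle>\<H> x, x\<rangle> - k \<parallel>C x\<parallel>\<^sup>2\<close>, which gives the Hautus
  inequality when \<open>\<bar>Re s\<bar>\<close> is large.

  The multiplier \<open>N(\<zeta>) = exp (- \<mu> \<zeta>) \<H> P\<^sub>1 \<H>\<close> turns \<open>Re \<langle>N x, P\<^sub>1 u'\<rangle>\<close> into half of the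
  integral of \<open>exp (- \<mu> \<zeta>) d/d\<zeta> (u\<^sup>* P\<^sub>1 \<H> P\<^sub>1 u)\<close>, up to lower order terms. As \<open>P\<^sub>1 \<H> P\<^sub>1\<close> is uniformly positive, partial integration and a large \<open>\<mu>\<close> give
  \<open>Re \<langle>N x, A x\<rangle> \<ge> L \<bar>\<langle>N x, x\<rangle>\<bar> + \<epsilon> \<parallel>x\<parallel>\<^sup>2 - k \<parallel>C x\<parallel>\<^sup>2\<close> for any prescribed \<open>L\<close>. As \<open>N\<close> is Hermitian, \<open>Im s\<close>
  does not contribute, so this covers every strip \<open>- L \<le> Re s < 0\<close>.

  If the output vanishes along a trajectory, \<open>\<langle>N x, x\<rangle>\<close> tends to zero and is therefore nonpositive, and the
  second inequality makes it decay faster than the first one permits the energy to decay, unless \<open>x = 0\<close>.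
\<close>

section \<open>Weak derivatives on the unit interval\<close>

text \<open>The closed and the half-open cut differ only by the null set \<open>{x}\<close>. Both
  occur because the two triangles of the square in the next proof have to be disjoint.\<close>

lemma integral_lebesgue_on_upto:
  fixes g :: "real \<Rightarrow> 'a::euclidean_space"
  assumes "0 \<le> x" "x \<le> b" and g: "integrable (lebesgue_on {0..b}) g"
  shows "integral\<^sup>L (lebesgue_on {0..b}) (\<lambda>y. indicator {..x} y *\<^sub>R g y) = integral\<^sup>L (lebesgue_on {0..x}) g"
    and "integral\<^sup>L (lebesgue_on {0..b}) (\<lambda>y. indicator {..<x} y *\<^sub>R g y) = integral\<^sup>L (lebesgue_on {0..x}) g"
proof -
  show 1: "integral\<^sup>L (lebesgue_on {0..b}) (\<lambda>y. indicator {..x} y *\<^sub>R g y) = integral\<^sup>L (lebesgue_on {0..x}) g"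
    using assms
    by (auto simp: integral_restrict_space indicator_def intro!: Bochner_Integration.integral_cong)
  have [measurable]: "g \<in> borel_measurable (lebesgue_on {0..b})"
    using g by auto
  have id [measurable]: "(\<lambda>x. x) \<in> borel_measurable (lebesgue_on {0..b})"
    using id_borel_measurable_lebesgue_on by (simp add: id_def)
  have "AE y in lebesgue_on {0..b}. y \<noteq> x"
    using AE_completion[OF AE_lborel_singleton[of x]] by (auto simp: AE_restrict_space_iff elim: eventually_mono)
  then have "integral\<^sup>L (lebesgue_on {0..b}) (\<lambda>y. indicator {..<x} y *\<^sub>R g y)
      = integral\<^sup>L (lebesgue_on {0..b}) (\<lambda>y. indicator {..x} y *\<^sub>R g y)"
    by (intro integral_cong_AE) (auto simp: indicator_def elim!: eventually_mono)
  with 1 show "integral\<^sup>L (lebesgue_on {0..b}) (\<lambda>y. indicator {..<x} y *\<^sub>R g y)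
      = integral\<^sup>L (lebesgue_on {0..x}) g" by simp
qed

text \<open>Integration by parts for indefinite integrals of merely integrable functions: Fubini
  replaces any pointwise differentiation. The right end \<open>b\<close> is arbitrary so that the
  formula is available at every point of the unit interval, and \<open>prod\<close> covers inner,
  scalar and matrix-vector products alike.\<close>

lemma indefinite_integral_bilinear:
  fixes prod :: "'a::euclidean_space \<Rightarrow> 'b::euclidean_space \<Rightarrow> 'c::euclidean_space"
    and b :: real
  assumes prod: "bounded_bilinear prod" and "0 \<le> b"
    and f: "integrable (lebesgue_on {0..b}) f" and g: "integrable (lebesgue_on {0..b}) g"
    and F: "\<And>t. t \<in> {0..b} \<Longrightarrow> F t = F 0 + integral\<^sup>L (lebesgue_on {0..t}) f"
    and G: "\<And>t. t \<in> {0..b} \<Longrightarrow> G t = G 0 + integral\<^sup>L (lebesgue_on {0..t}) g"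
  shows "integrable (lebesgue_on {0..b}) (\<lambda>t. prod (f t) (G t) + prod (F t) (g t))"
    and "prod (F b) (G b) = prod (F 0) (G 0) +
           integral\<^sup>L (lebesgue_on {0..b}) (\<lambda>t. prod (f t) (G t) + prod (F t) (g t))"
proof -
  interpret prod: bounded_bilinear prod by (rule prod)
  let ?M = "lebesgue_on {0..b}"
  interpret M: finite_measure ?M
    by (rule finite_measure_lebesgue_on) (rule lmeasurable_interval)
  interpret P: pair_sigma_finite ?M ?M ..
  have [measurable]: "f \<in> borel_measurable ?M" "g \<in> borel_measurable ?M"
    using f g by auto
  have [measurable]: "(\<lambda>p. prod (fst p) (snd p)) \<in> borel_measurable borel"
    by (intro borel_measurable_continuous_onI continuous_intros prod.continuous_on)
  obtain K where K: "K > 0" "\<And>x y. norm (prod x y) \<le> norm x * norm y * K"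
    using prod.pos_bounded by blast
  have id: "(\<lambda>x. x) \<in> ?M \<rightarrow>\<^sub>M borel" 
    using id_borel_measurable_lebesgue_on by (simp add: id_def)
  define a where "a = (\<lambda>p. prod (f (fst p)) (g (snd p)))"
  have a_meas [measurable]: "a \<in> borel_measurable (?M \<Otimes>\<^sub>M ?M)"
  proof -
    have "(\<lambda>p. (f (fst p), g (snd p))) \<in> (?M \<Otimes>\<^sub>M ?M) \<rightarrow>\<^sub>M borel"
      by (subst borel_prod[symmetric]) measurable
    from measurable_compose[OF this \<open>(\<lambda>p. prod (fst p) (snd p)) \<in> borel_measurable borel\<close>]
    show ?thesis by (simp add: a_def)
  qed
  have a_int: "integrable (?M \<Otimes>\<^sub>M ?M) a"
  proof (rule Bochner_Integration.integrable_bound)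
    show "integrable (?M \<Otimes>\<^sub>M ?M) (\<lambda>p. norm (f (fst p)) * norm (g (snd p)) * K)"
      by (rule P.Fubini_integrable) (use f g in \<open>auto simp: abs_mult\<close>)
    show "AE p in ?M \<Otimes>\<^sub>M ?M. norm (a p) \<le> norm (norm (f (fst p)) * norm (g (snd p)) * K)"
      using K by (auto simp: a_def intro!: AE_I2)
  qed measurable
  \<comment> \<open>The integral of \<open>prod (f x) (g y)\<close> over the square is split along the diagonal; Fubini on the
    two triangles gives the two terms of the product rule.\<close>
  define U where "U = {p :: real \<times> real. snd p \<le> fst p}"
  have U[measurable]: "Measurable.pred (?M \<Otimes>\<^sub>M ?M) (\<lambda>p. p \<in> U)"
  proof -
    have [measurable]: "fst \<in> (?M \<Otimes>\<^sub>M ?M) \<rightarrow>\<^sub>M borel" "snd \<in> (?M \<Otimes>\<^sub>M ?M) \<rightarrow>\<^sub>M borel"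
      using measurable_compose[OF measurable_fst id] measurable_compose[OF measurable_snd id] by auto
    show ?thesis unfolding U_def mem_Collect_eq by measurable
  qed
  have int1: "integrable (?M \<Otimes>\<^sub>M ?M) (\<lambda>p. indicator U p *\<^sub>R a p)"
    by (rule Bochner_Integration.integrable_bound[OF a_int]) (auto simp: indicator_def)
  have int2: "integrable (?M \<Otimes>\<^sub>M ?M) (\<lambda>p. indicator (- U) p *\<^sub>R a p)"
    by (rule Bochner_Integration.integrable_bound[OF a_int]) (auto simp: indicator_def)
  have 0: "0 \<in> {0..b}" and b: "b \<in> {0..b}" using \<open>0 \<le> b\<close> by auto
  have F': "integral\<^sup>L (lebesgue_on {0..t}) f = F t - F 0"
    and G': "integral\<^sup>L (lebesgue_on {0..t}) g = G t - G 0" if "t \<in> {0..b}" for t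
    using F[OF that] G[OF that] by simp_all
  have bl1: "bounded_linear (prod v)" for v by (rule prod.bounded_linear_right)
  have bl2: "bounded_linear (\<lambda>u. prod u v)" for v by (rule prod.bounded_linear_left)
  have in1: "integral\<^sup>L ?M (\<lambda>y. indicator U (x, y) *\<^sub>R a (x, y)) = prod (f x) (G x - G 0)"
    if "x \<in> {0..b}" for x
  proof -
    have "integral\<^sup>L ?M (\<lambda>y. indicator U (x, y) *\<^sub>R a (x, y))
        = integral\<^sup>L ?M (\<lambda>y. prod (f x) (indicator {..x} y *\<^sub>R g y))"
      by (auto simp: U_def a_def indicator_def prod.zero_right intro!: Bochner_Integration.integral_cong)
    also have "\<dots> = prod (f x) (integral\<^sup>L ?M (\<lambda>y. indicator {..x} y *\<^sub>R g y))"
      by (rule integral_bounded_linear[OF bl1])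
         (rule Bochner_Integration.integrable_bound[OF g], use id in \<open>auto simp: indicator_def\<close>)
    finally show ?thesis
      using that integral_lebesgue_on_upto(1)[OF _ _ g, of x] G'[OF that] by simp
  qed
  have in2: "integral\<^sup>L ?M (\<lambda>x. indicator (- U) (x, y) *\<^sub>R a (x, y)) = prod (F y - F 0) (g y)"
    if "y \<in> {0..b}" for y
  proof -
    have "integral\<^sup>L ?M (\<lambda>x. indicator (- U) (x, y) *\<^sub>R a (x, y))
        = integral\<^sup>L ?M (\<lambda>x. prod (indicator {..<y} x *\<^sub>R f x) (g y))"
      by (auto simp: U_def a_def indicator_def prod.zero_left intro!: Bochner_Integration.integral_cong)
    also have "\<dots> = prod (integral\<^sup>L ?M (\<lambda>x. indicator {..<y} x *\<^sub>R f x)) (g y)"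
      by (rule integral_bounded_linear[OF bl2])
         (rule Bochner_Integration.integrable_bound[OF f], use id in \<open>auto simp: indicator_def\<close>)
    finally show ?thesis
      using that integral_lebesgue_on_upto(2)[OF _ _ f, of y] F'[OF that] by simp
  qed
  \<comment> \<open>Over the whole square the integral factorises, because the variables of the
    integrand are separated.\<close>
  have all: "integral\<^sup>L (?M \<Otimes>\<^sub>M ?M) a = prod (F b - F 0) (G b - G 0)"
  proof -
    have "integral\<^sup>L (?M \<Otimes>\<^sub>M ?M) a = (\<integral>x. (\<integral>y. a (x, y) \<partial>?M) \<partial>?M)"
      by (rule P.integral_fst'[OF a_int, symmetric])
    also have "\<dots> = (\<integral>x. prod (f x) (G b - G 0) \<partial>?M)"
      by (simp add: a_def integral_bounded_linear[OF bl1 g] G'[OF b])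
    also have "\<dots> = prod (F b - F 0) (G b - G 0)"
      by (simp add: integral_bounded_linear[OF bl2 f] F'[OF b])
    finally show ?thesis .
  qed
  have i1: "integrable ?M (\<lambda>x. prod (f x) (G x - G 0))"
    using P.integrable_fst'[OF int1] by (rule iffD1[OF Bochner_Integration.integrable_cong, rotated 2]) (auto simp: in1)
  have e1: "integral\<^sup>L ?M (\<lambda>x. prod (f x) (G x - G 0)) = integral\<^sup>L (?M \<Otimes>\<^sub>M ?M) (\<lambda>p. indicator U p *\<^sub>R a p)"
    unfolding P.integral_fst'[OF int1, symmetric] by (rule Bochner_Integration.integral_cong) (auto simp: in1)
  have int2': "integrable (?M \<Otimes>\<^sub>M ?M) (\<lambda>(x, y). indicator (- U) (x, y) *\<^sub>R a (x, y))"
    using int2 by (simp add: case_prod_unfold)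
  have i2: "integrable ?M (\<lambda>y. prod (F y - F 0) (g y))"
    using P.integrable_snd[OF int2'] by (rule iffD1[OF Bochner_Integration.integrable_cong, rotated 2]) (auto simp: in2)
  have e2: "integral\<^sup>L ?M (\<lambda>y. prod (F y - F 0) (g y)) = integral\<^sup>L (?M \<Otimes>\<^sub>M ?M) (\<lambda>p. indicator (- U) p *\<^sub>R a p)"
  proof -
    have "integral\<^sup>L ?M (\<lambda>y. prod (F y - F 0) (g y)) = (\<integral>y. (\<integral>x. indicator (- U) (x, y) *\<^sub>R a (x, y) \<partial>?M) \<partial>?M)"
      by (rule Bochner_Integration.integral_cong) (auto simp: in2)
    then show ?thesis using P.integral_snd[OF int2'] by (simp add: case_prod_unfold)
  qed
  have "integral\<^sup>L (?M \<Otimes>\<^sub>M ?M) (\<lambda>p. indicator U p *\<^sub>R a p) + integral\<^sup>L (?M \<Otimes>\<^sub>M ?M) (\<lambda>p. indicator (- U) p *\<^sub>R a p)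
      = integral\<^sup>L (?M \<Otimes>\<^sub>M ?M) a"
    by (subst Bochner_Integration.integral_add[OF int1 int2, symmetric])
       (auto simp: indicator_def intro!: Bochner_Integration.integral_cong)
  with e1 e2 all have sum: "integral\<^sup>L ?M (\<lambda>x. prod (f x) (G x - G 0)) + integral\<^sup>L ?M (\<lambda>y. prod (F y - F 0) (g y))
      = prod (F b - F 0) (G b - G 0)" by simp
  have j1: "integrable ?M (\<lambda>x. prod (f x) (G 0))" and j2: "integrable ?M (\<lambda>x. prod (F 0) (g x))"
    using integrable_bounded_linear[OF bl2 f] integrable_bounded_linear[OF bl1 g] by auto
  \<comment> \<open>The triangles only see \<open>F - F 0\<close> and \<open>G - G 0\<close>. The
    initial values are put back as terms that are linear in \<open>f\<close> or \<open>g\<close> and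
    integrate directly.\<close>
  have eq: "(\<lambda>t. prod (f t) (G t) + prod (F t) (g t)) = (\<lambda>t. (prod (f t) (G t - G 0) + prod (F t - F 0) (g t)) +
      (prod (f t) (G 0) + prod (F 0) (g t)))"
    by (auto simp: prod.diff_left prod.diff_right)
  show "integrable (lebesgue_on {0..b}) (\<lambda>t. prod (f t) (G t) + prod (F t) (g t))"
    unfolding eq using i1 i2 j1 j2 by auto
  have split: "integral\<^sup>L ?M (\<lambda>t. prod (f t) (G t) + prod (F t) (g t))
      = (integral\<^sup>L ?M (\<lambda>t. prod (f t) (G t - G 0)) + integral\<^sup>L ?M (\<lambda>t. prod (F t - F 0) (g t)))
        + (integral\<^sup>L ?M (\<lambda>t. prod (f t) (G 0)) + integral\<^sup>L ?M (\<lambda>t. prod (F 0) (g t)))"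
    unfolding eq using i1 i2 j1 j2
    by (simp only: Bochner_Integration.integral_add Bochner_Integration.integrable_add)
  have "integral\<^sup>L ?M (\<lambda>x. prod (f x) (G 0)) = prod (F b - F 0) (G 0)"
    "integral\<^sup>L ?M (\<lambda>x. prod (F 0) (g x)) = prod (F 0) (G b - G 0)"
    by (simp_all add: integral_bounded_linear[OF bl2 f] integral_bounded_linear[OF bl1 g] F'[OF b] G'[OF b])
  then show "prod (F b) (G b) = prod (F 0) (G 0) +
           integral\<^sup>L (lebesgue_on {0..b}) (\<lambda>t. prod (f t) (G t) + prod (F t) (g t))"
    using sum split by (simp add: prod.diff_left prod.diff_right)
qed

section \<open>Matrices\<close>

lemma bounded_bilinear_matrix_vector_mult:
  "bounded_bilinear ((*v) :: complex^'n^'m \<Rightarrow> complex^'n \<Rightarrow> complex^'m)"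
  unfolding bilinear_conv_bounded_bilinear[symmetric] bilinear_def linear_iff
  by (auto simp: matrix_vector_right_distrib matrix_vector_mult_add_rdistrib matrix_vector_mult_scaleR
      matrix_vector_mult_def vec_eq_iff scaleR_sum_right algebra_simps sum.distrib)

lemma bounded_bilinear_matrix_matrix_mult:
  "bounded_bilinear ((**) :: complex^'n^'m \<Rightarrow> complex^'k^'n \<Rightarrow> complex^'k^'m)"
  unfolding bilinear_conv_bounded_bilinear[symmetric] bilinear_def linear_iff
  by (auto simp: matrix_matrix_mult_def vec_eq_iff scaleR_sum_right algebra_simps sum.distrib)

lemma inner_complex_vec: "(v :: complex^'n) \<bullet> w = Re (\<Sum>i\<in>UNIV. cnj (v $ i) * w $ i)"
  by (simp add: inner_vec_def inner_complex_def)

text \<open>The real inner product is the real part of the complex one, so the adjoint with respect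
  to it is still the conjugate transpose.\<close>

lemma inner_matrix_vector_mult:
  "((M :: complex^'n^'m) *v v) \<bullet> w = v \<bullet> (ctranspose M *v w)"
proof -
  have "(\<Sum>i\<in>UNIV. cnj ((M *v v) $ i) * w $ i) = (\<Sum>i\<in>UNIV. \<Sum>j\<in>UNIV. cnj (M $ i $ j) * cnj (v $ j) * w $ i)"
    by (simp add: matrix_vector_mult_def sum_distrib_right)
  also have "\<dots> = (\<Sum>j\<in>UNIV. \<Sum>i\<in>UNIV. cnj (M $ i $ j) * cnj (v $ j) * w $ i)"
    by (rule sum.swap)
  also have "\<dots> = (\<Sum>j\<in>UNIV. cnj (v $ j) * (ctranspose M *v w) $ j)"
    by (simp add: matrix_vector_mult_def ctranspose_def sum_distrib_left mult_ac)
  finally show ?thesis by (simp add: inner_complex_vec)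
qed

lemma hermitian_inner:
  "hermitian M \<Longrightarrow> (M *v v) \<bullet> w = v \<bullet> (M *v w)"
  by (simp add: inner_matrix_vector_mult hermitian_def)

lemma inner_cscale_left: "(c *s v) \<bullet> (w :: complex^'n) = v \<bullet> (cnj c *s w)"
  by (simp add: inner_complex_vec sum_distrib_left mult_ac)

lemma matrix_vector_mult_cscale: "(M :: complex^'n^'m) *v (c *s v) = c *s (M *v v)"
  by (simp add: matrix_vector_mult_def vec_eq_iff sum_distrib_left mult_ac)

text \<open>A Hermitian form takes real values, so the imaginary part of \<open>c\<close>
  contributes a purely imaginary number, which the real inner product does not see. This is how the
  imaginary part of \<open>s\<close> drops out of the Hautus estimates.\<close>

lemma inner_hermitian_cscale:
  assumes "hermitian M"
  shows "(M *v v) \<bullet> (c *s v) = Re c * ((M *v v) \<bullet> v)"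
proof -
  have "(M *v v) \<bullet> (\<i> *s v) = v \<bullet> (\<i> *s (M *v v))"
    by (simp add: hermitian_inner[OF assms] matrix_vector_mult_cscale)
  also have "\<dots> = - ((M *v v) \<bullet> (\<i> *s v))"
  proof -
    have "(- \<i>) *s v = - (\<i> *s v)" by (simp add: vec_eq_iff)
    then have "(\<i> *s (M *v v)) \<bullet> v = (M *v v) \<bullet> - (\<i> *s v)" by (simp add: inner_cscale_left)
    then show ?thesis by (simp add: inner_commute[of v])
  qed
  finally have 0: "(M *v v) \<bullet> (\<i> *s v) = 0" by simp
  have "c *s v = Re c *\<^sub>R v + Im c *\<^sub>R (\<i> *s v)"
    by (simp add: vec_eq_iff complex_eq_iff)
  then show ?thesis by (simp add: inner_add_right 0)
qed

lemma matrix_inv: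
  assumes "invertible (M :: complex^'n^'m)"
  shows "M ** matrix_inv M = mat 1" and "matrix_inv M ** M = mat 1"
  using someI_ex[OF assms[unfolded invertible_def]] by (auto simp: matrix_inv_def)

text \<open>Evaluating the nonnegative form of \<open>M\<close> at \<open>K v - z\<close>, where
  \<open>z\<close> is the preimage of \<open>v\<close> under \<open>M\<close>, turns a bound for the
  inverse into a lower bound for \<open>M\<close>. No eigenvalues or square roots of matrices are
  involved.\<close>

lemma positive_hermitian_coercive:
  fixes M :: "complex^'n^'n"
  assumes pos: "positive_hermitian M" and K: "\<And>v. norm (matrix_inv M *v v) \<le> K * norm v" "0 < K"
  shows "(norm v)\<^sup>2 \<le> K * (v \<bullet> (M *v v))"
proof -
  have herm: "hermitian M" using pos by (simp add: positive_hermitian_def)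
  have nonneg: "w \<bullet> (M *v w) \<ge> 0" for w
    using pos by (cases "w = 0"; auto simp: positive_hermitian_def less_imp_le)
  have inj: "M *v w = 0 \<Longrightarrow> w = 0" for w
    using pos by (fastforce simp: positive_hermitian_def)
  then have inv: "invertible M"
    by (simp add: invertible_left_inverse matrix_left_invertible_ker)
  define z where "z = matrix_inv M *v v"
  have Mz: "M *v z = v"
    using matrix_inv(1)[OF inv] by (simp add: z_def matrix_vector_mul_assoc)
  have "z \<bullet> v \<le> norm z * norm v" by (rule norm_cauchy_schwarz)
  also have "\<dots> \<le> K * norm v * norm v"
    using K(1)[of v] by (simp add: z_def mult_right_mono)
  finally have zv: "z \<bullet> v \<le> K * (v \<bullet> v)" by (simp add: power2_norm_eq_inner[symmetric] power2_eq_square)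
  have "0 \<le> (K *\<^sub>R v - z) \<bullet> (M *v (K *\<^sub>R v - z))" by (rule nonneg)
  also have "\<dots> = K\<^sup>2 * (v \<bullet> (M *v v)) - 2 * K * (v \<bullet> v) + z \<bullet> v"
  proof -
    have "z \<bullet> (M *v v) = v \<bullet> v"
      using hermitian_inner[OF herm, of z v] by (simp add: Mz)
    then show ?thesis
      by (simp add: matrix_vector_mult_diff_distrib Mz inner_diff
          bounded_bilinear.scaleR_right[OF bounded_bilinear_matrix_vector_mult] power2_eq_square algebra_simps)
  qed
  also have "\<dots> \<le> K\<^sup>2 * (v \<bullet> (M *v v)) - K * (v \<bullet> v)" using zv by simp
  finally have "K * (v \<bullet> v) \<le> K * (K * (v \<bullet> (M *v v)))" by (simp add: power2_eq_square mult_ac)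
  with \<open>0 < K\<close> show ?thesis by (simp add: power2_norm_eq_inner)
qed

lemma norm_vstack: "(norm (vstack u v :: complex^('n::finite+'m::finite)))\<^sup>2 = (norm u)\<^sup>2 + (norm v)\<^sup>2"
proof -
  have "(\<Sum>i\<in>UNIV. f i) = (\<Sum>i\<in>UNIV. f (Inl i)) + (\<Sum>i\<in>UNIV. f (Inr i))" for f :: "'n + 'm \<Rightarrow> real"
    by (simp add: UNIV_Plus_UNIV[symmetric] sum.Plus del: UNIV_Plus_UNIV)
  then show ?thesis by (simp add: power2_norm_eq_inner inner_vec_def vstack_def)
qed

lemma vstack_matrix_vector_mult: "vstack M N *v v = vstack (M *v v) (N *v v)"
  by (simp add: vec_eq_iff vstack_def matrix_vector_mult_def split: sum.split)

lemma vstack_diff: "vstack (u - u') (v - v') = vstack u v - (vstack u' v' :: complex^('n::finite+'m::finite))"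
  by (simp add: vec_eq_iff vstack_def split: sum.split)

section \<open>Representatives of elements of \<open>L\<^sup>2\<close>\<close>

lemma square_integrable_rep_L2: "square_integrable (rep_L2 x)"
  using Quotient3_L2 unfolding Quotient3_def L2_rel_def by metis

lemma rep_abs_L2: "square_integrable f \<Longrightarrow> AE t in unit_lebesgue. rep_L2 (abs_L2 f) t = f t"
  using rep_abs_rsp[OF Quotient3_L2, of f f] by (auto simp: L2_rel_def elim: eventually_mono)

lemma L2_eqI: "AE t in unit_lebesgue. rep_L2 x t = rep_L2 y t \<Longrightarrow> x = y"
  using Quotient3_rel_rep[OF Quotient3_L2, of x y] square_integrable_rep_L2
  by (auto simp: L2_rel_def)

lemma inner_L2_rep: "x \<bullet> y = integral\<^sup>L unit_lebesgue (\<lambda>t. rep_L2 x t \<bullet> rep_L2 y t)"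
  by (simp add: inner_L2_def)

lemma rep_L2_add: "AE t in unit_lebesgue. rep_L2 (x + y) t = rep_L2 x t + rep_L2 y t"
  unfolding plus_L2_def by (simp add: rep_abs_L2 square_integrable_add square_integrable_rep_L2)

lemma rep_L2_diff: "AE t in unit_lebesgue. rep_L2 (x - y) t = rep_L2 x t - rep_L2 y t"
  unfolding minus_L2_def by (simp add: rep_abs_L2 square_integrable_diff square_integrable_rep_L2)

lemma rep_L2_scaleR: "AE t in unit_lebesgue. rep_L2 (r *\<^sub>R y) t = r *\<^sub>R rep_L2 y t"
  unfolding scaleR_L2_def by (simp add: rep_abs_L2 square_integrable_scaleR square_integrable_rep_L2)

lemma rep_L2_cscale: "AE t in unit_lebesgue. rep_L2 (cscale c y) t = c *s rep_L2 y t"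
  unfolding cscale_def by (simp add: rep_abs_L2 square_integrable_cscale square_integrable_rep_L2)

lemma norm_L2_rep: "(norm x)\<^sup>2 = integral\<^sup>L unit_lebesgue (\<lambda>t. (norm (rep_L2 x t))\<^sup>2)"
  by (simp add: power2_norm_eq_inner inner_L2_rep)

text \<open>Absolute continuity written as an indefinite integral. The derivative is only required
  to be integrable, not square integrable as in \<open>H1_rep\<close>, so that the notion is closed
  under products.\<close>

definition has_weak_derivative :: "(real \<Rightarrow> 'a::euclidean_space) \<Rightarrow> (real \<Rightarrow> 'a) \<Rightarrow> bool" where
  "has_weak_derivative F f \<longleftrightarrow> integrable unit_lebesgue f \<and>
     (\<forall>t\<in>{0..1}. F t = F 0 + integral\<^sup>L (lebesgue_on {0..t}) f)"

lemma integrable_lebesgue_on_subinterval: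
  fixes f :: "real \<Rightarrow> 'a::euclidean_space"
  assumes "integrable (lebesgue_on {a..b}) f" "{c..d} \<subseteq> {a..b}"
  shows "integrable (lebesgue_on {c..d}) f"
proof -
  have "integrable lebesgue (\<lambda>x. indicator {c..d} x *\<^sub>R (indicator {a..b} x *\<^sub>R f x))"
    by (rule integrable_mult_indicator) (use assms(1) in \<open>auto simp: integrable_restrict_space\<close>)
  moreover have "indicator {c..d} x *\<^sub>R (indicator {a..b} x *\<^sub>R f x) = indicator {c..d} x *\<^sub>R f x" for x
    using assms(2) by (auto simp: indicator_def)
  ultimately have "integrable lebesgue (\<lambda>x. indicator {c..d} x *\<^sub>R f x)" by (simp only:)
  then show ?thesis by (simp add: integrable_restrict_space)
qed

text \<open>Integrability of the new derivative comes from the product rule with right end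
  \<open>1\<close>, the integral formula from the right ends \<open>t\<close>. Applying it twice
  differentiates a quadratic form with variable coefficients.\<close>

lemma has_weak_derivative_bilinear:
  fixes prod :: "'a::euclidean_space \<Rightarrow> 'b::euclidean_space \<Rightarrow> 'c::euclidean_space"
  assumes prod: "bounded_bilinear prod" and F: "has_weak_derivative F f" and G: "has_weak_derivative G g"
  shows "has_weak_derivative (\<lambda>t. prod (F t) (G t)) (\<lambda>t. prod (f t) (G t) + prod (F t) (g t))"
  unfolding has_weak_derivative_def
proof (intro conjI ballI)
  have f: "integrable unit_lebesgue f" and F': "\<And>t. t \<in> {0..1} \<Longrightarrow> F t = F 0 + integral\<^sup>L (lebesgue_on {0..t}) f"
    using F unfolding has_weak_derivative_def by blast+
  have g: "integrable unit_lebesgue g" and G': "\<And>t. t \<in> {0..1} \<Longrightarrow> G t = G 0 + integral\<^sup>L (lebesgue_on {0..t}) g"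
    using G unfolding has_weak_derivative_def by blast+
  show "integrable unit_lebesgue (\<lambda>t. prod (f t) (G t) + prod (F t) (g t))"
    by (rule indefinite_integral_bilinear(1)[of prod 1 f g F G]) (fact prod f g F' G' zero_le_one)+
  fix t :: real assume t: "t \<in> {0..1}"
  have F'': "\<And>s. s \<in> {0..t} \<Longrightarrow> F s = F 0 + integral\<^sup>L (lebesgue_on {0..s}) f"
    and G'': "\<And>s. s \<in> {0..t} \<Longrightarrow> G s = G 0 + integral\<^sup>L (lebesgue_on {0..s}) g"
    using t by (auto intro!: F' G')
  have f': "integrable (lebesgue_on {0..t}) f" and g': "integrable (lebesgue_on {0..t}) g"
    using f g t by (auto intro!: integrable_lebesgue_on_subinterval[of 0 1 _ 0 t])
  have "0 \<le> t" using t by simp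
  show "prod (F t) (G t) = prod (F 0) (G 0) +
      integral\<^sup>L (lebesgue_on {0..t}) (\<lambda>t. prod (f t) (G t) + prod (F t) (g t))"
    by (rule indefinite_integral_bilinear(2)[of prod t f g F G]) (fact prod f' g' F'' G'' \<open>0 \<le> t\<close>)+
qed

lemma has_weak_derivative_const: "has_weak_derivative (\<lambda>_. c) (\<lambda>_. 0)"
  by (simp add: has_weak_derivative_def)

lemma has_weak_derivative_C1:
  fixes f :: "real \<Rightarrow> 'a::euclidean_space"
  assumes "\<And>t. t \<in> {0..1} \<Longrightarrow> (f has_vector_derivative f' t) (at t within {0..1})"
    and cont: "continuous_on {0..1} f'"
  shows "has_weak_derivative f f'"
proof -
  have "f t = f 0 + integral\<^sup>L (lebesgue_on {0..t}) f'" if t: "t \<in> {0..1}" for t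
  proof -
    have "(f' has_integral (f t - f 0)) {0..t}"
      using t by (intro fundamental_theorem_of_calculus)
        (auto intro!: has_vector_derivative_within_subset[OF assms(1)])
    moreover have "continuous_on {0..t} f'"
      using cont t by (auto intro: continuous_on_subset)
    then have "integrable (lebesgue_on {0..t}) f'"
      by (rule continuous_imp_integrable_real)
    then have "(f' has_integral integral\<^sup>L (lebesgue_on {0..t}) f') {0..t}"
      by (intro has_integral_integral_lebesgue_on) auto
    ultimately show ?thesis
      by (metis add.commute diff_add_cancel has_integral_unique)
  qed
  with continuous_imp_integrable_real[OF cont] show ?thesis
    unfolding has_weak_derivative_def by blast
qed

lemma has_weak_derivative_continuous:
  fixes F :: "real \<Rightarrow> 'a::euclidean_space"
  assumes "has_weak_derivative F f"
  shows "continuous_on {0..1} F"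
proof -
  have "continuous_on {0..1} (\<lambda>t. F 0 + integral\<^sup>L (lebesgue_on {0..t}) f)"
    using assms by (intro continuous_intros indefinite_integral_continuous_real)
      (simp add: has_weak_derivative_def)
  then show ?thesis
  proof (rule iffD2[OF continuous_on_cong[OF refl], rotated])
    fix t :: real assume "t \<in> {0..1}"
    then show "F t = F 0 + integral\<^sup>L (lebesgue_on {0..t}) f"
      using assms unfolding has_weak_derivative_def by blast
  qed
qed

text \<open>The norm of the difference is continuous and nonnegative with integral zero, hence
  vanishes everywhere. The end points are included, which makes boundary values well
  defined.\<close>

lemma continuous_AE_eq:
  fixes f g :: "real \<Rightarrow> 'a::euclidean_space"
  assumes "continuous_on {0..1} f" "continuous_on {0..1} g"
    and ae: "AE t in unit_lebesgue. f t = g t" and "t \<in> {0..1}"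
  shows "f t = g t"
proof -
  have cont: "continuous_on {0..1} (\<lambda>t. norm (f t - g t))"
    using assms by (intro continuous_intros)
  then have int: "integrable unit_lebesgue (\<lambda>t. norm (f t - g t))"
    by (rule continuous_imp_integrable_real)
  have "integral {0..1} (\<lambda>t. norm (f t - g t)) = integral\<^sup>L unit_lebesgue (\<lambda>t. norm (f t - g t))"
    using has_integral_integral_lebesgue_on[OF int] by auto
  also have "\<dots> = 0"
    using ae by (intro integral_eq_zero_AE) auto
  finally show ?thesis
    using integral_eq_0_iff[OF cont] \<open>t \<in> {0..1}\<close> by auto
qed

section \<open>Representatives and derivatives of functions in the Sobolev space\<close>

lemma square_integrable_imp_integrable:
  fixes f :: "real \<Rightarrow> 'a::euclidean_space"
  assumes "square_integrable f"
  shows "integrable unit_lebesgue f"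
proof (rule Bochner_Integration.integrable_bound)
  show "integrable unit_lebesgue (\<lambda>t. 1 + (norm (f t))\<^sup>2)"
    using assms continuous_imp_integrable_real[of 0 1 "\<lambda>_. 1::real"]
    by (auto simp: square_integrable_def)
  have "norm (f t) \<le> 1 + (norm (f t))\<^sup>2" for t
    using sum_squares_bound[of 1 "norm (f t)"] norm_ge_zero[of "f t"] unfolding one_power2 by linarith
  then show "AE t in unit_lebesgue. norm (f t) \<le> norm (1 + (norm (f t))\<^sup>2)" by simp
qed (use assms in \<open>simp add: square_integrable_def\<close>)

lemma H1_rep_has_weak_derivative:
  assumes "H1_rep f u g"
  shows "has_weak_derivative u (rep_L2 g)"
  using assms square_integrable_imp_integrable[OF square_integrable_rep_L2]
  unfolding H1_rep_def has_weak_derivative_def by blast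

lemma H1_rep_unique:
  assumes u: "H1_rep f u g" and v: "H1_rep f v h" and t: "t \<in> {0..1}"
  shows "u t = v t"
proof (rule continuous_AE_eq[OF _ _ _ t])
  show "continuous_on {0..1} u" "continuous_on {0..1} v"
    using u v by (blast intro: has_weak_derivative_continuous H1_rep_has_weak_derivative)+
  show "AE t in unit_lebesgue. u t = v t"
    using u v unfolding H1_rep_def by (auto elim: eventually_elim2)
qed

text \<open>\<open>H1_fun\<close> and \<open>H1_deriv\<close> are chosen independently of each
  other. They fit together because the continuous representative is unique on the unit
  interval.\<close>

lemma H1_rep_H1_fun:
  assumes "f \<in> H1"
  shows "H1_rep f (H1_fun f) (H1_deriv f)"
proof -
  have ex: "\<exists>u g. H1_rep f u g" "\<exists>g u. H1_rep f u g" using assms by (auto simp: H1_def)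
  obtain g where g: "H1_rep f (H1_fun f) g"
    using someI_ex[OF ex(1)] by (auto simp: H1_fun_def)
  obtain u where u: "H1_rep f u (H1_deriv f)"
    using someI_ex[OF ex(2)] by (auto simp: H1_deriv_def)
  show ?thesis
    unfolding H1_rep_def
  proof (intro conjI ballI)
    show "AE t in unit_lebesgue. rep_L2 f t = H1_fun f t" using g unfolding H1_rep_def by blast
    fix t :: real assume t: "t \<in> {0..1}"
    then have "u t = u 0 + integral\<^sup>L (lebesgue_on {0..t}) (rep_L2 (H1_deriv f))"
      using u unfolding H1_rep_def by blast
    then show "H1_fun f t = H1_fun f 0 + integral\<^sup>L (lebesgue_on {0..t}) (rep_L2 (H1_deriv f))"
      using H1_rep_unique[OF g u] t by simp
  qed
qed

lemma H1_fun_unique: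
  assumes "H1_rep f u g" "t \<in> {0..1}"
  shows "H1_fun f t = u t"
  using assms by (intro H1_rep_unique[OF H1_rep_H1_fun]) (auto simp: H1_def)

text \<open>Integrates the derivative of \<open>u \<bullet> (R *v u)\<close>, where symmetry of
  \<open>R\<close> merges the two terms containing \<open>g\<close>. Since \<open>R\<close> is
  Hermitian only almost everywhere, the integrand \<open>d\<close> is described almost everywhere,
  which is enough for comparing integrals.\<close>

lemma weak_derivative_hermitian_form:
  fixes u :: "real \<Rightarrow> complex^'n"
  assumes u: "has_weak_derivative u g" and R: "has_weak_derivative R R'"
    and herm: "AE t in unit_lebesgue. hermitian (R t)"
  obtains d where "integrable unit_lebesgue d"
    and "integral\<^sup>L unit_lebesgue d = u 1 \<bullet> (R 1 *v u 1) - u 0 \<bullet> (R 0 *v u 0)"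
    and "AE t in unit_lebesgue. d t = u t \<bullet> (R' t *v u t) + 2 * (u t \<bullet> (R t *v g t))"
proof -
  let ?d = "\<lambda>t. g t \<bullet> (R t *v u t) + u t \<bullet> (R' t *v u t + R t *v g t)"
  let ?e = "\<lambda>t. u t \<bullet> (R' t *v u t) + 2 * (u t \<bullet> (R t *v g t))"
  have w: "has_weak_derivative (\<lambda>t. u t \<bullet> (R t *v u t)) ?d"
    by (intro has_weak_derivative_bilinear[OF bounded_bilinear_inner] u R
        has_weak_derivative_bilinear[OF bounded_bilinear_matrix_vector_mult])
  have ae: "AE t in unit_lebesgue. ?d t = ?e t"
    using herm proof eventually_elim
      case (elim t)
      then show ?case
        using hermitian_inner[of "R t" "g t" "u t"]
        by (simp add: inner_add_right inner_commute[of "u t" "R t *v g t"])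
    qed
  show thesis
  proof (rule that[OF _ _ ae])
    show "integrable unit_lebesgue ?d" using w unfolding has_weak_derivative_def by blast
    show "integral\<^sup>L unit_lebesgue ?d = u 1 \<bullet> (R 1 *v u 1) - u 0 \<bullet> (R 0 *v u 0)"
      using w[unfolded has_weak_derivative_def, THEN conjunct2, rule_format, of 1] by simp
  qed
qed

section \<open>Multiplication operators with essentially bounded matrix symbols\<close>

lemma mult_op_square_integrable:
  fixes M :: "real \<Rightarrow> complex^'n^'n"
  assumes "Linfinity M" "square_integrable f"
  shows "square_integrable (\<lambda>t. M t *v f t)"
proof -
  interpret mv: bounded_bilinear "(*v) :: complex^'n^'n \<Rightarrow> complex^'n \<Rightarrow> complex^'n"
    by (rule bounded_bilinear_matrix_vector_mult)
  obtain C where C: "C > 0" "\<And>A v. norm (A *v v :: complex^'n) \<le> norm (A :: complex^'n^'n) * norm v * C"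
    using mv.pos_bounded by blast
  obtain K where K: "AE t in unit_lebesgue. norm (M t) \<le> K" using assms by (auto simp: Linfinity_def)
  have [measurable]: "M \<in> borel_measurable unit_lebesgue" "f \<in> borel_measurable unit_lebesgue"
    using assms by (auto simp: Linfinity_def square_integrable_def)
  have meas [measurable]: "(\<lambda>t. M t *v f t) \<in> borel_measurable unit_lebesgue"
    by (intro borel_measurable_continuous_Pair[where H="(*v)"])
       (auto intro!: mv.continuous_on continuous_intros)
  have "integrable unit_lebesgue (\<lambda>t. (norm (M t *v f t))\<^sup>2)"
  proof (rule Bochner_Integration.integrable_bound)
    show "integrable unit_lebesgue (\<lambda>t. (K * C)\<^sup>2 * (norm (f t))\<^sup>2)"
      using assms by (auto simp: square_integrable_def)
    show "AE t in unit_lebesgue. norm ((norm (M t *v f t))\<^sup>2) \<le> norm ((K * C)\<^sup>2 * (norm (f t))\<^sup>2)"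
      using K
    proof eventually_elim
      case (elim t)
      have "norm (M t *v f t) \<le> norm (M t) * norm (f t) * C" by (rule C)
      also have "\<dots> \<le> K * norm (f t) * C"
        using elim C by (intro mult_right_mono) auto
      finally have "(norm (M t *v f t))\<^sup>2 \<le> (K * norm (f t) * C)\<^sup>2"
        by (intro power_mono) auto
      then show ?case by (simp add: power_mult_distrib mult_ac)
    qed
  qed measurable
  with meas show ?thesis by (simp add: square_integrable_def)
qed

lemma rep_mult_op:
  "Linfinity M \<Longrightarrow> AE t in unit_lebesgue. rep_L2 (mult_op M x) t = M t *v rep_L2 x t"
  unfolding mult_op_def
  by (intro rep_abs_L2 mult_op_square_integrable square_integrable_rep_L2)

lemma mult_op_add:
  assumes M: "Linfinity M"
  shows "mult_op M (x + y) = mult_op M x + mult_op M y"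
proof (rule L2_eqI)
  show "AE t in unit_lebesgue. rep_L2 (mult_op M (x + y)) t = rep_L2 (mult_op M x + mult_op M y) t"
    using rep_mult_op[OF M, of "x + y"] rep_mult_op[OF M, of x] rep_mult_op[OF M, of y]
      rep_L2_add[of x y] rep_L2_add[of "mult_op M x" "mult_op M y"]
    by eventually_elim (simp add: matrix_vector_right_distrib)
qed

lemma mult_op_scaleR:
  assumes M: "Linfinity M"
  shows "mult_op M (r *\<^sub>R x) = r *\<^sub>R mult_op M x"
proof (rule L2_eqI)
  show "AE t in unit_lebesgue. rep_L2 (mult_op M (r *\<^sub>R x)) t = rep_L2 (r *\<^sub>R mult_op M x) t"
    using rep_mult_op[OF M, of "r *\<^sub>R x"] rep_mult_op[OF M, of x]
      rep_L2_scaleR[of r x] rep_L2_scaleR[of r "mult_op M x"]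
    by eventually_elim (simp add: bounded_bilinear.scaleR_right[OF bounded_bilinear_matrix_vector_mult])
qed

lemma bounded_linear_mult_op:
  fixes M :: "real \<Rightarrow> complex^'n^'n"
  assumes M: "Linfinity M"
  shows "bounded_linear (mult_op M)"
proof -
  obtain C where C: "C > 0" "\<And>A v. norm (A *v v :: complex^'n) \<le> norm (A :: complex^'n^'n) * norm v * C"
    using bounded_bilinear.pos_bounded[OF bounded_bilinear_matrix_vector_mult] by blast
  obtain K where K: "AE t in unit_lebesgue. norm (M t) \<le> K" using M by (auto simp: Linfinity_def)
  show ?thesis
  proof (rule bounded_linear_intro[where K="\<bar>K\<bar> * C"])
    fix x :: "(complex^'n) L2"
    have "(norm (mult_op M x))\<^sup>2 \<le> integral\<^sup>L unit_lebesgue (\<lambda>t. (\<bar>K\<bar> * C)\<^sup>2 * (norm (rep_L2 x t))\<^sup>2)"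
      unfolding norm_L2_rep
    proof (rule integral_mono_AE)
      show "AE t in unit_lebesgue. (norm (rep_L2 (mult_op M x) t))\<^sup>2 \<le> (\<bar>K\<bar> * C)\<^sup>2 * (norm (rep_L2 x t))\<^sup>2"
        using rep_mult_op[OF M, of x] K
      proof eventually_elim
        case (elim t)
        have "norm (rep_L2 (mult_op M x) t) \<le> norm (M t) * norm (rep_L2 x t) * C"
          using elim C by simp
        also have "\<dots> \<le> \<bar>K\<bar> * norm (rep_L2 x t) * C"
          using elim C by (intro mult_right_mono) auto
        finally have "(norm (rep_L2 (mult_op M x) t))\<^sup>2 \<le> (\<bar>K\<bar> * norm (rep_L2 x t) * C)\<^sup>2"
          by (intro power_mono) auto
        then show ?case by (simp add: power_mult_distrib mult_ac)
      qed
    qed (use square_integrable_rep_L2[of x] square_integrable_rep_L2[of "mult_op M x"] in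
        \<open>auto simp: square_integrable_def\<close>)
    also have "\<dots> = (\<bar>K\<bar> * C * norm x)\<^sup>2"
      by (simp add: norm_L2_rep power_mult_distrib)
    finally have "norm (mult_op M x) \<le> \<bar>K\<bar> * C * norm x"
      by (rule power2_le_imp_le) (use C(1) in simp)
    then show "norm (mult_op M x) \<le> norm x * (\<bar>K\<bar> * C)" by (simp only: mult.commute)
  qed (use M in \<open>simp_all add: mult_op_add mult_op_scaleR\<close>)
qed

text \<open>The pointwise identity for Hermitian matrices, integrated. It is used with
  \<open>c = s\<close> for the symbol \<open>H\<close> and for the multiplier
  \<open>N\<close>.\<close>

lemma inner_mult_op_cscale:
  assumes M: "Linfinity M" and herm: "AE t in unit_lebesgue. hermitian (M t)"
  shows "mult_op M x \<bullet> cscale c x = Re c * (mult_op M x \<bullet> x)"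
proof -
  have "mult_op M x \<bullet> cscale c x = integral\<^sup>L unit_lebesgue (\<lambda>t. Re c * (rep_L2 (mult_op M x) t \<bullet> rep_L2 x t))"
    unfolding inner_L2_rep
  proof (rule integral_cong_AE)
    show "AE t in unit_lebesgue. rep_L2 (mult_op M x) t \<bullet> rep_L2 (cscale c x) t = Re c * (rep_L2 (mult_op M x) t \<bullet> rep_L2 x t)"
      using rep_mult_op[OF M, of x] rep_L2_cscale[of c x] herm
      by eventually_elim (simp add: inner_hermitian_cscale)
  qed (use square_integrable_rep_L2[of x] square_integrable_rep_L2[of "mult_op M x"]
      square_integrable_rep_L2[of "cscale c x"] in \<open>auto simp: square_integrable_def\<close>)
  then show ?thesis by (simp add: inner_L2_rep)
qed

lemma inner_mult_op_commute:
  assumes M: "Linfinity M" and herm: "AE t in unit_lebesgue. hermitian (M t)"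
  shows "mult_op M x \<bullet> y = x \<bullet> mult_op M y"
  unfolding inner_L2_rep
proof (rule integral_cong_AE)
  show "AE t in unit_lebesgue. rep_L2 (mult_op M x) t \<bullet> rep_L2 y t = rep_L2 x t \<bullet> rep_L2 (mult_op M y) t"
    using rep_mult_op[OF M, of x] rep_mult_op[OF M, of y] herm
    by eventually_elim (simp add: hermitian_inner)
qed (use square_integrable_rep_L2[of x] square_integrable_rep_L2[of "mult_op M x"]
    square_integrable_rep_L2[of "mult_op M y"] square_integrable_rep_L2[of y] in \<open>auto simp: square_integrable_def\<close>)

section \<open>Quadratic forms of a port-Hamiltonian operator\<close>

lemma matrix_vector_mult_bound:
  obtains c where "c > 0" and "\<And>v. norm ((M :: complex^'n^'m) *v v) \<le> c * norm v"
  using bounded_linear.pos_bounded[OF bounded_bilinear.bounded_linear_right[OF bounded_bilinear_matrix_vector_mult], of M]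
  by (metis mult.commute)

lemma invertible_vector_bound:
  fixes M :: "complex^'n^'m"
  assumes "invertible M"
  obtains c where "c > 0" and "\<And>v. norm v \<le> c * norm (M *v v)"
proof -
  obtain c where c: "c > 0" "\<And>v. norm (matrix_inv M *v v) \<le> c * norm v"
    using matrix_vector_mult_bound by blast
  have "norm v \<le> c * norm (M *v v)" for v
    using c(2)[of "M *v v"] by (simp add: matrix_vector_mul_assoc matrix_inv(2)[OF assms])
  with c(1) that show thesis by blast
qed

lemma continuous_matrix_vector_bound:
  fixes M :: "real \<Rightarrow> complex^'n^'m"
  assumes "continuous_on {0..1} M"
  obtains c where "c > 0" and "\<And>t v. t \<in> {0..1} \<Longrightarrow> norm (M t *v v) \<le> c * norm v"
proof -
  obtain C where C: "C > 0" "\<And>A v. norm ((A :: complex^'n^'m) *v v) \<le> norm A * norm v * C"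
    using bounded_bilinear.pos_bounded[OF bounded_bilinear_matrix_vector_mult] by blast
  have "bounded (M ` {0..1})"
    using assms by (intro compact_imp_bounded compact_continuous_image) auto
  then obtain B where B: "B > 0" "\<And>t. t \<in> {0..1} \<Longrightarrow> norm (M t) \<le> B"
    unfolding bounded_pos by auto
  have "norm (M t *v v) \<le> B * C * norm v" if "t \<in> {0..1}" for t v
  proof -
    have "norm (M t *v v) \<le> norm (M t) * (norm v * C)" using C(2)[of "M t" v] by (simp add: mult_ac)
    also have "\<dots> \<le> B * (norm v * C)" using B(2)[OF that] C(1) by (intro mult_right_mono) auto
    finally show ?thesis by (simp add: mult_ac)
  qed
  with B(1) C(1) that[of "B * C"] show thesis by simp
qed

lemma continuous_Linfinity:
  fixes M :: "real \<Rightarrow> 'a::euclidean_space"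
  assumes "continuous_on {0..1} M"
  shows "Linfinity M"
proof -
  have "bounded (M ` {0..1})"
    using assms by (intro compact_imp_bounded compact_continuous_image) auto
  then obtain B where B: "\<forall>y\<in>M ` {0..1}. norm y \<le> B"
    unfolding bounded_pos by blast
  then have "AE t in unit_lebesgue. norm (M t) \<le> B"
    by (intro AE_I2) (use B in auto)
  moreover have "M \<in> borel_measurable unit_lebesgue"
    using continuous_imp_integrable_real[OF assms] by simp
  ultimately show ?thesis by (auto simp: Linfinity_def)
qed

lemma Linfinity_const: "Linfinity (\<lambda>_. c)"
  by (intro continuous_Linfinity continuous_intros)

lemma ctranspose_mult: "ctranspose (X ** Y) = ctranspose Y ** ctranspose (X :: complex^'n^'m)"
  by (simp add: ctranspose_def matrix_matrix_mult_def vec_eq_iff mult.commute)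

text \<open>The diagonalisation is kept in the form of a continuously differentiable function
  \<open>H\<^sub>0\<close> that agrees with \<open>H\<close> almost everywhere. The operators are
  still those of \<open>H\<close>, and \<open>H\<^sub>0\<close> takes its place wherever a
  derivative or continuity is needed. The single constant \<open>K\<close> bounds \<open>H\<close>
  from above and from below.\<close>

locale port_hamiltonian =
  fixes P\<^sub>1 G\<^sub>0 W\<^sub>B\<^sub>1 W\<^sub>B\<^sub>0 W\<^sub>C\<^sub>1 W\<^sub>C\<^sub>0 :: "complex^'n^'n"
    and H H\<^sub>0 H\<^sub>0' :: "real \<Rightarrow> complex^'n^'n" and K :: real
  assumes P1_hermitian: "hermitian P\<^sub>1" and P1_invertible: "invertible P\<^sub>1"
    and W_invertible: "invertible (vstack (hblock W\<^sub>B\<^sub>1 W\<^sub>B\<^sub>0) (hblock W\<^sub>C\<^sub>1 W\<^sub>C\<^sub>0))"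
    and H_Linfinity: "Linfinity H"
    and H_eq: "AE t in unit_lebesgue. H t = H\<^sub>0 t"
    and H_hermitian: "AE t in unit_lebesgue. hermitian (H t)"
    and K_pos: "K > 0"
    and H_upper: "AE t in unit_lebesgue. \<forall>v. norm (H t *v v) \<le> K * norm v"
    and H_lower: "AE t in unit_lebesgue. \<forall>v. (norm v)\<^sup>2 \<le> K * (v \<bullet> (H t *v v))"
    and H0_derivative: "\<And>t. t \<in> {0..1} \<Longrightarrow> (H\<^sub>0 has_vector_derivative H\<^sub>0' t) (at t within {0..1})"
    and H0'_continuous: "continuous_on {0..1} H\<^sub>0'"
begin

abbreviation "D \<equiv> phs_domain W\<^sub>B\<^sub>1 W\<^sub>B\<^sub>0 H"
abbreviation "A \<equiv> phs_operator P\<^sub>1 G\<^sub>0 H"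
abbreviation "C \<equiv> phs_output W\<^sub>C\<^sub>1 W\<^sub>C\<^sub>0 H"

text \<open>Cauchy-Schwarz cancels one factor \<open>norm v\<close> in the coercivity bound. This
  recovers the size of the state from \<open>u = H x\<close> pointwise.\<close>

lemma H_lower': "AE t in unit_lebesgue. \<forall>v. norm v \<le> K * norm (H t *v v)"
  using H_lower
proof eventually_elim
  case (elim t)
  have "norm v \<le> K * norm (H t *v v)" for v
  proof (cases "v = 0")
    case False
    have "norm v * norm v \<le> K * (v \<bullet> (H t *v v))"
      using elim by (simp add: power2_eq_square)
    also have "\<dots> \<le> K * (norm v * norm (H t *v v))"
      using K_pos by (intro mult_left_mono norm_cauchy_schwarz) auto
    finally have "norm v * norm v \<le> norm v * (K * norm (H t *v v))" by (simp add: mult_ac)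
    then show ?thesis using False by simp
  qed simp
  then show ?case ..
qed

text \<open>On the domain the upper half of the stacked matrix annihilates the boundary vector and
  the lower half gives the output, so the inverse of the stacked matrix bounds all boundary values
  by the output. Every boundary term below is absorbed in this way.\<close>

lemma boundary_values_bound:
  obtains k where "k > 0" and "\<And>x. x \<in> D \<Longrightarrow> norm (boundary_values H x) \<le> k * norm (C x)"
proof -
  obtain k where k: "k > 0"
    "\<And>v. norm v \<le> k * norm (vstack (hblock W\<^sub>B\<^sub>1 W\<^sub>B\<^sub>0) (hblock W\<^sub>C\<^sub>1 W\<^sub>C\<^sub>0) *v v)"
    using invertible_vector_bound[OF W_invertible] by blast
  have "norm (boundary_values H x) \<le> k * norm (C x)" if "x \<in> D" for x
  proof -
    have "(norm (vstack (0::complex^'n) (C x)))\<^sup>2 = (norm (C x))\<^sup>2" by (simp add: norm_vstack)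
    then have "norm (vstack (0::complex^'n) (C x)) = norm (C x)" by simp
    with that k(2)[of "boundary_values H x"] show ?thesis
      by (simp add: vstack_matrix_vector_mult phs_domain_def phs_output_def)
  qed
  with k(1) that show thesis by blast
qed

text \<open>Passes from classes to functions: \<open>u\<close> is the continuous representative of
  \<open>H x\<close>, with weak derivative \<open>g\<close>. The pointwise computations with the
  operator start from here.\<close>

lemma domain_representatives:
  assumes "x \<in> D"
  obtains u g where "has_weak_derivative u g"
    and "AE t in unit_lebesgue. u t = H t *v rep_L2 x t"
    and "AE t in unit_lebesgue. rep_L2 (A x) t = P\<^sub>1 *v g t + G\<^sub>0 *v u t"
    and "(norm (boundary_values H x))\<^sup>2 = (norm (u 1))\<^sup>2 + (norm (u 0))\<^sup>2"
proof -
  let ?f = "mult_op H x"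
  have "?f \<in> H1" using assms by (simp add: phs_domain_def)
  then have rep: "H1_rep ?f (H1_fun ?f) (H1_deriv ?f)" by (rule H1_rep_H1_fun)
  show thesis
  proof (rule that[OF H1_rep_has_weak_derivative[OF rep]])
    have eq: "AE t in unit_lebesgue. rep_L2 ?f t = H1_fun ?f t"
      using rep unfolding H1_rep_def by blast
    with rep_mult_op[OF H_Linfinity, of x]
    show "AE t in unit_lebesgue. H1_fun ?f t = H t *v rep_L2 x t"
      by eventually_elim simp
    show "AE t in unit_lebesgue. rep_L2 (A x) t = P\<^sub>1 *v rep_L2 (H1_deriv ?f) t + G\<^sub>0 *v H1_fun ?f t"
      using eq rep_mult_op[OF Linfinity_const, of P\<^sub>1 "H1_deriv ?f"] rep_mult_op[OF Linfinity_const, of G\<^sub>0 ?f]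
        rep_L2_add[of "mult_op (\<lambda>_. P\<^sub>1) (H1_deriv ?f)" "mult_op (\<lambda>_. G\<^sub>0) ?f"]
      unfolding phs_operator_def by eventually_elim simp
  qed (simp add: boundary_values_def norm_vstack)
qed

lemma boundary_form_bound:
  fixes M\<^sub>1 M\<^sub>0 :: "complex^'n^'n"
  assumes c: "\<And>v. norm (M\<^sub>1 *v v) \<le> c * norm v" "\<And>v. norm (M\<^sub>0 *v v) \<le> c * norm v"
  shows "u\<^sub>1 \<bullet> (M\<^sub>1 *v u\<^sub>1) - u\<^sub>0 \<bullet> (M\<^sub>0 *v u\<^sub>0) \<ge> - (c * ((norm u\<^sub>1)\<^sup>2 + (norm u\<^sub>0)\<^sup>2))"
proof -
  have *: "\<bar>u \<bullet> (M *v u)\<bar> \<le> c * (norm u)\<^sup>2" if "\<And>v. norm (M *v v) \<le> c * norm v" for u :: "complex^'n" and M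
  proof -
    have "\<bar>u \<bullet> (M *v u)\<bar> \<le> norm u * norm (M *v u)" by (rule Cauchy_Schwarz_ineq2)
    also have "\<dots> \<le> norm u * (c * norm u)" by (intro mult_left_mono that) auto
    finally show ?thesis by (simp add: power2_eq_square mult_ac)
  qed
  from *[OF c(1), of u\<^sub>1] *[OF c(2), of u\<^sub>0] show ?thesis by (simp add: algebra_simps)
qed

text \<open>As \<open>P\<^sub>1\<close> is constant and Hermitian, twice the inner product of
  \<open>u\<close> and \<open>P\<^sub>1 *v v\<close> integrates to a pure boundary term, which the
  output controls. What remains is the form of \<open>G\<^sub>0\<close>, which is bounded by a
  multiple of the energy.\<close>

lemma energy_estimate:
  obtains g k where "g \<ge> 0" "k \<ge> 0"
    and "\<And>x. x \<in> D \<Longrightarrow> mult_op H x \<bullet> A x \<ge> - g * (mult_op H x \<bullet> x) - k * (norm (C x))\<^sup>2"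
proof -
  obtain k where k: "k > 0" "\<And>x. x \<in> D \<Longrightarrow> norm (boundary_values H x) \<le> k * norm (C x)"
    using boundary_values_bound by blast
  obtain c where c: "c > 0" "\<And>v. norm (P\<^sub>1 *v v) \<le> c * norm v" using matrix_vector_mult_bound by blast
  obtain g where g: "g > 0" "\<And>v. norm (G\<^sub>0 *v v) \<le> g * norm v" using matrix_vector_mult_bound by blast
  have "2 * (mult_op H x \<bullet> A x) \<ge> - (2 * g * K ^ 3) * (mult_op H x \<bullet> x) - c * k\<^sup>2 * (norm (C x))\<^sup>2"
    if x: "x \<in> D" for x
  proof -
    obtain u v where u: "has_weak_derivative u v"
      and uH: "AE t in unit_lebesgue. u t = H t *v rep_L2 x t"
      and Ax: "AE t in unit_lebesgue. rep_L2 (A x) t = P\<^sub>1 *v v t + G\<^sub>0 *v u t"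
      and bv: "(norm (boundary_values H x))\<^sup>2 = (norm (u 1))\<^sup>2 + (norm (u 0))\<^sup>2"
      using domain_representatives[OF x] by blast
    obtain d where d: "integrable unit_lebesgue d"
      "integral\<^sup>L unit_lebesgue d = u 1 \<bullet> (P\<^sub>1 *v u 1) - u 0 \<bullet> (P\<^sub>1 *v u 0)"
      "AE t in unit_lebesgue. d t = u t \<bullet> (0 *v u t) + 2 * (u t \<bullet> (P\<^sub>1 *v v t))"
      using weak_derivative_hermitian_form[OF u has_weak_derivative_const[of P\<^sub>1]] P1_hermitian by auto
    let ?h = "\<lambda>t. rep_L2 (mult_op H x) t"
    have "integral\<^sup>L unit_lebesgue (\<lambda>t. d t - (2 * g * K ^ 3) * (?h t \<bullet> rep_L2 x t))
        \<le> integral\<^sup>L unit_lebesgue (\<lambda>t. 2 * (?h t \<bullet> rep_L2 (A x) t))"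
    proof (rule integral_mono_AE)
      show "integrable unit_lebesgue (\<lambda>t. d t - (2 * g * K ^ 3) * (?h t \<bullet> rep_L2 x t))"
        "integrable unit_lebesgue (\<lambda>t. 2 * (?h t \<bullet> rep_L2 (A x) t))"
        using d(1) by (auto intro!: square_integrable_inner square_integrable_rep_L2)
      show "AE t in unit_lebesgue. d t - (2 * g * K ^ 3) * (?h t \<bullet> rep_L2 x t) \<le> 2 * (?h t \<bullet> rep_L2 (A x) t)"
        using d(3) uH Ax rep_mult_op[OF H_Linfinity, of x] H_upper H_lower
      proof eventually_elim
        case (elim t)
        \<comment> \<open>Two of the three factors \<open>K\<close> come from estimating
          \<open>u = H x\<close> by \<open>x\<close>, the third from estimating the squared norm of
          \<open>x\<close> by its energy density.\<close>
        have "\<bar>u t \<bullet> (G\<^sub>0 *v u t)\<bar> \<le> norm (u t) * norm (G\<^sub>0 *v u t)" by (rule Cauchy_Schwarz_ineq2)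
        also have "\<dots> \<le> norm (u t) * (g * norm (u t))" by (intro mult_left_mono g) auto
        also have "\<dots> = g * (norm (u t))\<^sup>2" by (simp add: power2_eq_square)
        also have "\<dots> \<le> g * (K * norm (rep_L2 x t))\<^sup>2"
          using elim g(1) by (intro mult_left_mono power_mono) auto
        also have "\<dots> = g * K\<^sup>2 * (norm (rep_L2 x t))\<^sup>2" by (simp add: power_mult_distrib)
        also have "\<dots> \<le> g * K\<^sup>2 * (K * (rep_L2 x t \<bullet> (H t *v rep_L2 x t)))"
          using elim g(1) by (intro mult_left_mono) auto
        finally have "\<bar>u t \<bullet> (G\<^sub>0 *v u t)\<bar> \<le> g * K ^ 3 * (?h t \<bullet> rep_L2 x t)"
          using elim by (simp add: inner_commute power2_eq_square power3_eq_cube mult_ac)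
        then show ?case using elim by (simp add: inner_add_right)
      qed
    qed
    also have "\<dots> = 2 * (mult_op H x \<bullet> A x)" by (simp add: inner_L2_rep)
    also have "integral\<^sup>L unit_lebesgue (\<lambda>t. d t - (2 * g * K ^ 3) * (?h t \<bullet> rep_L2 x t))
        = u 1 \<bullet> (P\<^sub>1 *v u 1) - u 0 \<bullet> (P\<^sub>1 *v u 0) - (2 * g * K ^ 3) * (mult_op H x \<bullet> x)"
      using d(1,2) by (simp add: inner_L2_rep square_integrable_inner square_integrable_rep_L2)
    finally have "2 * (mult_op H x \<bullet> A x) \<ge> u 1 \<bullet> (P\<^sub>1 *v u 1) - u 0 \<bullet> (P\<^sub>1 *v u 0) - (2 * g * K ^ 3) * (mult_op H x \<bullet> x)" .
    moreover have "u 1 \<bullet> (P\<^sub>1 *v u 1) - u 0 \<bullet> (P\<^sub>1 *v u 0) \<ge> - (c * (norm (boundary_values H x))\<^sup>2)"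
      unfolding bv by (rule boundary_form_bound) (rule c)+
    moreover have "c * (norm (boundary_values H x))\<^sup>2 \<le> c * (k * norm (C x))\<^sup>2"
      using c(1) k(2)[OF x] by (intro mult_left_mono power_mono) auto
    ultimately show ?thesis by (simp add: power_mult_distrib)
  qed
  then show thesis
    using g(1) c(1) K_pos by (intro that[of "g * K ^ 3" "c * k\<^sup>2 / 2"]) (auto simp: field_simps)
qed

text \<open>Since \<open>N x\<close> is \<open>w\<close> times \<open>H P\<^sub>1 u\<close>, pairing
  it with \<open>P\<^sub>1 v\<close> gives the form of \<open>R = w P\<^sub>1 H P\<^sub>1\<close> in
  \<open>u\<close> and \<open>v\<close>. Conjugation by \<open>P\<^sub>1\<close>, which may be
  indefinite, keeps \<open>H\<close> positive. Integration by parts replaces the form by boundary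
  terms minus half the integral of the form of \<open>R'\<close>, and the decreasing weight makes
  \<open>- R'\<close> as positive as desired.\<close>

lemma multiplier_estimate:
  assumes L: "L \<ge> 0"
  obtains N \<epsilon> k where "Linfinity N" "AE t in unit_lebesgue. hermitian (N t)" "\<epsilon> > 0" "k \<ge> 0"
    and "\<And>x. x \<in> D \<Longrightarrow> mult_op N x \<bullet> A x
           \<ge> L * \<bar>mult_op N x \<bullet> x\<bar> + \<epsilon> * (norm x)\<^sup>2 - k * (norm (C x))\<^sup>2"
proof -
  interpret mm: bounded_bilinear "(**) :: complex^'n^'n \<Rightarrow> complex^'n^'n \<Rightarrow> complex^'n^'n"
    by (rule bounded_bilinear_matrix_matrix_mult)
  interpret mv: bounded_bilinear "(*v) :: complex^'n^'n \<Rightarrow> complex^'n \<Rightarrow> complex^'n"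
    by (rule bounded_bilinear_matrix_vector_mult)
  obtain k where k: "k > 0" "\<And>x. x \<in> D \<Longrightarrow> norm (boundary_values H x) \<le> k * norm (C x)"
    using boundary_values_bound by blast
  obtain c where c: "c > 0" "\<And>v. norm (P\<^sub>1 *v v) \<le> c * norm v" using matrix_vector_mult_bound by blast
  obtain p where p: "p > 0" "\<And>v. norm v \<le> p * norm (P\<^sub>1 *v v)"
    using invertible_vector_bound[OF P1_invertible] by blast
  obtain g where g: "g > 0" "\<And>v. norm (G\<^sub>0 *v v) \<le> g * norm v" using matrix_vector_mult_bound by blast
  define Q where "Q t = P\<^sub>1 ** H\<^sub>0 t ** P\<^sub>1" for t
  define Q' where "Q' t = P\<^sub>1 ** H\<^sub>0' t ** P\<^sub>1" for t
  have H0_cont: "continuous_on {0..1} H\<^sub>0"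
    by (rule has_weak_derivative_continuous[OF has_weak_derivative_C1[OF H0_derivative H0'_continuous]])
  have Q'_cont: "continuous_on {0..1} Q'"
    unfolding Q'_def by (intro mm.continuous_on continuous_intros H0'_continuous)
  have Q_deriv: "(Q has_vector_derivative Q' t) (at t within {0..1})" if "t \<in> {0..1}" for t
    unfolding Q_def Q'_def
    by (rule bounded_linear.has_vector_derivative[OF bounded_linear_compose[OF mm.bounded_linear_left mm.bounded_linear_right] H0_derivative[OF that]])
  then have Q_cont: "continuous_on {0..1} Q"
    by (rule has_weak_derivative_continuous[OF has_weak_derivative_C1[OF _ Q'_cont]])
  obtain q where q: "q > 0" "\<And>t v. t \<in> {0..1} \<Longrightarrow> norm (Q' t *v v) \<le> q * norm v"
    using continuous_matrix_vector_bound[OF Q'_cont] by blast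
  \<comment> \<open>The summands pay, in this order, for the derivative of \<open>Q\<close>, for the
    \<open>G\<^sub>0\<close> term, for the prescribed multiple of the form of \<open>N\<close>, and
    for a remaining margin. The prefactor \<open>K p\<^sup>2\<close> is the constant in the
    coercivity of \<open>Q\<close>.\<close>
  define \<mu> where "\<mu> = K * p\<^sup>2 * (q + 2 * K * c * g + 2 * L * K\<^sup>2 * c + 1)"
  have "\<mu> \<ge> 0" using L c(1) g(1) q(1) K_pos by (auto simp: \<mu>_def)
  define w where "w t = exp (- \<mu> * t)" for t :: real
  have w_pos: "w t > 0" for t by (simp add: w_def)
  define R where "R t = w t *\<^sub>R Q t" for t
  define R' where "R' t = w t *\<^sub>R (Q' t - \<mu> *\<^sub>R Q t)" for t
  define N where "N t = w t *\<^sub>R (H\<^sub>0 t ** P\<^sub>1 ** H\<^sub>0 t)" for t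
  have w_cont: "continuous_on {0..1} w" unfolding w_def by (intro continuous_intros)
  have w_deriv: "(w has_real_derivative (- \<mu> * w t)) (at t within {0..1})" for t
    unfolding w_def by (auto intro!: derivative_eq_intros)
  have R: "has_weak_derivative R R'"
  proof (rule has_weak_derivative_C1)
    fix t :: real assume t: "t \<in> {0..1}"
    show "(R has_vector_derivative R' t) (at t within {0..1})"
      unfolding R_def R'_def
      by (rule has_vector_derivative_eq_rhs, rule has_vector_derivative_scaleR[OF w_deriv Q_deriv[OF t]])
         (simp add: algebra_simps)
  next
    show "continuous_on {0..1} R'"
      unfolding R'_def by (intro continuous_intros w_cont Q'_cont Q_cont)
  qed
  have R_cont: "continuous_on {0..1} R" by (rule has_weak_derivative_continuous[OF R])
  obtain r where r: "r > 0" "\<And>t v. t \<in> {0..1} \<Longrightarrow> norm (R t *v v) \<le> r * norm v"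
    using continuous_matrix_vector_bound[OF R_cont] by blast
  have N: "Linfinity N"
    unfolding N_def by (intro continuous_Linfinity continuous_intros w_cont mm.continuous_on H0_cont)
  have herm_conj: "hermitian (X ** Y ** X)" if "hermitian X" "hermitian Y" for X Y :: "complex^'n^'n"
    using that by (simp add: hermitian_def ctranspose_mult matrix_mul_assoc)
  have herm_scale: "hermitian (s *\<^sub>R X)" if "hermitian X" for X :: "complex^'n^'n" and s
    using that by (simp add: hermitian_def ctranspose_def vec_eq_iff)
  \<comment> \<open>\<open>R\<close> and \<open>N\<close> are built from the smooth
    \<open>H\<^sub>0\<close>, whereas symmetry is known for \<open>H\<close>; it carries over almost
    everywhere.\<close>
  have R_herm: "AE t in unit_lebesgue. hermitian (R t)"
    using H_eq H_hermitian
    by eventually_elim (simp add: R_def Q_def herm_scale herm_conj P1_hermitian)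
  have N_herm: "AE t in unit_lebesgue. hermitian (N t)"
    using H_eq H_hermitian
    by eventually_elim (simp add: N_def herm_scale herm_conj P1_hermitian)
  have "2 * (mult_op N x \<bullet> A x) \<ge> 2 * L * \<bar>mult_op N x \<bullet> x\<bar> + exp (- \<mu>) / K\<^sup>2 * (norm x)\<^sup>2
      - r * k\<^sup>2 * (norm (C x))\<^sup>2" if x: "x \<in> D" for x
  proof -
    obtain u v where u: "has_weak_derivative u v"
      and uH: "AE t in unit_lebesgue. u t = H t *v rep_L2 x t"
      and Ax: "AE t in unit_lebesgue. rep_L2 (A x) t = P\<^sub>1 *v v t + G\<^sub>0 *v u t"
      and bv: "(norm (boundary_values H x))\<^sup>2 = (norm (u 1))\<^sup>2 + (norm (u 0))\<^sup>2"
      using domain_representatives[OF x] by blast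
    obtain d where d: "integrable unit_lebesgue d"
      "integral\<^sup>L unit_lebesgue d = u 1 \<bullet> (R 1 *v u 1) - u 0 \<bullet> (R 0 *v u 0)"
      "AE t in unit_lebesgue. d t = u t \<bullet> (R' t *v u t) + 2 * (u t \<bullet> (R t *v v t))"
      using weak_derivative_hermitian_form[OF u R R_herm] by auto
    let ?n = "\<lambda>t. rep_L2 (mult_op N x) t" and ?y = "rep_L2 x"
    have int: "integrable unit_lebesgue (\<lambda>t. ?n t \<bullet> ?y t)" "integrable unit_lebesgue (\<lambda>t. ?n t \<bullet> rep_L2 (A x) t)"
      "integrable unit_lebesgue (\<lambda>t. (norm (?y t))\<^sup>2)"
      using square_integrable_rep_L2[of x]
      by (auto intro!: square_integrable_inner square_integrable_rep_L2 simp: square_integrable_def)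
    \<comment> \<open>The absolute value is taken inside the integral, which is stronger than needed
      but reduces the claim to a pointwise inequality.\<close>
    have "integral\<^sup>L unit_lebesgue (\<lambda>t. d t + 2 * L * \<bar>?n t \<bullet> ?y t\<bar> + exp (- \<mu>) / K\<^sup>2 * (norm (?y t))\<^sup>2)
        \<le> integral\<^sup>L unit_lebesgue (\<lambda>t. 2 * (?n t \<bullet> rep_L2 (A x) t))"
    proof (rule integral_mono_AE)
      show "integrable unit_lebesgue (\<lambda>t. d t + 2 * L * \<bar>?n t \<bullet> ?y t\<bar> + exp (- \<mu>) / K\<^sup>2 * (norm (?y t))\<^sup>2)"
        "integrable unit_lebesgue (\<lambda>t. 2 * (?n t \<bullet> rep_L2 (A x) t))"
        using d(1) int by auto
      have "AE t in unit_lebesgue. t \<in> {0..1}" by (intro AE_I2) simp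
      then show "AE t in unit_lebesgue. d t + 2 * L * \<bar>?n t \<bullet> ?y t\<bar> + exp (- \<mu>) / K\<^sup>2 * (norm (?y t))\<^sup>2 \<le> 2 * (?n t \<bullet> rep_L2 (A x) t)"
        using d(3) uH Ax rep_mult_op[OF N, of x] H_upper H_lower H_lower' H_eq H_hermitian
      proof eventually_elim
        case (elim t)
        define U where "U = u t"
        define y where "y = ?y t"
        define a where "a = norm U"
        have t: "t \<in> {0..1}" and Uy: "U = H t *v y" using elim by (auto simp: U_def y_def)
        have HH: "H t = H\<^sub>0 t" using elim by blast
        have dteq: "d t = U \<bullet> (R' t *v U) + 2 * (U \<bullet> (R t *v v t))"
          and Axt: "rep_L2 (A x) t = P\<^sub>1 *v v t + G\<^sub>0 *v U" and nt: "?n t = N t *v y"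
          unfolding U_def y_def by (fact elim)+
        have herm: "(H t *v z) \<bullet> z' = z \<bullet> (H t *v z')" for z z'
          using elim by (intro hermitian_inner) auto
        have hermP: "(P\<^sub>1 *v z) \<bullet> z' = z \<bullet> (P\<^sub>1 *v z')" for z z'
          by (intro hermitian_inner P1_hermitian)
        have n: "?n t = w t *\<^sub>R (H t *v (P\<^sub>1 *v U))"
          by (simp add: nt N_def HH[symmetric] Uy mv.scaleR_left matrix_vector_mul_assoc[symmetric])
        have Qv: "Q t *v z = P\<^sub>1 *v (H t *v (P\<^sub>1 *v z))" for z
          by (simp add: Q_def HH[symmetric] matrix_vector_mul_assoc[symmetric])
        have "norm (H t *v (P\<^sub>1 *v U)) \<le> K * norm (P\<^sub>1 *v U)" using elim by auto
        also have "\<dots> \<le> K * (c * a)" using K_pos c(2)[of U] by (auto simp: a_def)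
        finally have HPU: "norm (H t *v (P\<^sub>1 *v U)) \<le> K * c * a" by (simp add: mult_ac)
        have ya: "norm y \<le> K * a" using elim by (auto simp: a_def Uy)
        have "a \<ge> 0" by (simp add: a_def)
        \<comment> \<open>Coercivity of \<open>Q\<close>: positivity of \<open>H\<close> at the
          vector \<open>P\<^sub>1 U\<close>, combined with invertibility of
          \<open>P\<^sub>1\<close>.\<close>
        have 1: "a\<^sup>2 \<le> K * p\<^sup>2 * (U \<bullet> (Q t *v U))"
        proof -
          have "a\<^sup>2 \<le> (p * norm (P\<^sub>1 *v U))\<^sup>2" unfolding a_def using p by (intro power_mono) auto
          also have "\<dots> = p\<^sup>2 * (norm (P\<^sub>1 *v U))\<^sup>2" by (simp add: power_mult_distrib)
          also have "\<dots> \<le> p\<^sup>2 * (K * ((P\<^sub>1 *v U) \<bullet> (H t *v (P\<^sub>1 *v U))))"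
            using elim by (intro mult_left_mono) auto
          finally show ?thesis by (simp add: Qv hermP mult_ac)
        qed
        have 2: "U \<bullet> (Q' t *v U) \<le> q * a\<^sup>2"
        proof -
          have "U \<bullet> (Q' t *v U) \<le> a * norm (Q' t *v U)" unfolding a_def by (rule norm_cauchy_schwarz)
          also have "\<dots> \<le> a * (q * a)" using q(2)[OF t, of U] \<open>a \<ge> 0\<close> by (intro mult_left_mono) (auto simp: a_def)
          finally show ?thesis by (simp add: power2_eq_square mult_ac)
        qed
        have 3: "\<bar>(H t *v (P\<^sub>1 *v U)) \<bullet> (G\<^sub>0 *v U)\<bar> \<le> K * c * g * a\<^sup>2"
        proof -
          have "\<bar>(H t *v (P\<^sub>1 *v U)) \<bullet> (G\<^sub>0 *v U)\<bar> \<le> norm (H t *v (P\<^sub>1 *v U)) * norm (G\<^sub>0 *v U)"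
            by (rule Cauchy_Schwarz_ineq2)
          also have "\<dots> \<le> (K * c * a) * (g * a)"
            using HPU g(2)[of U] K_pos c(1) \<open>a \<ge> 0\<close> by (intro mult_mono) (auto simp: a_def)
          finally show ?thesis by (simp add: power2_eq_square mult_ac)
        qed
        have 4: "\<bar>(H t *v (P\<^sub>1 *v U)) \<bullet> y\<bar> \<le> K\<^sup>2 * c * a\<^sup>2"
        proof -
          have "\<bar>(H t *v (P\<^sub>1 *v U)) \<bullet> y\<bar> \<le> norm (H t *v (P\<^sub>1 *v U)) * norm y"
            by (rule Cauchy_Schwarz_ineq2)
          also have "\<dots> \<le> (K * c * a) * (K * a)"
            using HPU ya K_pos c(1) \<open>a \<ge> 0\<close> by (intro mult_mono) auto
          finally show ?thesis by (simp add: power2_eq_square mult_ac)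
        qed
        \<comment> \<open>On the unit interval the weight is at least \<open>exp (- \<mu>)\<close>,
          so the margin \<open>w a\<^sup>2\<close> dominates a fixed multiple of the squared norm of
          the state.\<close>
        have 5: "exp (- \<mu>) / K\<^sup>2 * (norm y)\<^sup>2 \<le> w t * a\<^sup>2"
        proof -
          have "(norm y)\<^sup>2 \<le> K\<^sup>2 * a\<^sup>2" using ya power_mono[OF ya, of 2] by (simp add: power_mult_distrib)
          then have "exp (- \<mu>) / K\<^sup>2 * (norm y)\<^sup>2 \<le> exp (- \<mu>) * a\<^sup>2"
            using K_pos by (simp add: field_simps)
          also have "\<dots> \<le> w t * a\<^sup>2"
            using \<open>\<mu> \<ge> 0\<close> t by (intro mult_right_mono) (auto simp: w_def mult_left_le)
          finally show ?thesis .
        qed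
        have 6: "\<mu> * (U \<bullet> (Q t *v U)) \<ge> (q + 2 * K * c * g + 2 * L * K\<^sup>2 * c + 1) * a\<^sup>2"
        proof -
          have "(q + 2 * K * c * g + 2 * L * K\<^sup>2 * c + 1) * a\<^sup>2
              \<le> (q + 2 * K * c * g + 2 * L * K\<^sup>2 * c + 1) * (K * p\<^sup>2 * (U \<bullet> (Q t *v U)))"
            using 1 L q(1) c(1) g(1) K_pos by (intro mult_left_mono) auto
          then show ?thesis by (simp add: \<mu>_def mult_ac)
        qed
        \<comment> \<open>The derivative \<open>v t\<close> cannot be bounded by \<open>u t\<close>.
          It enters this identity and \<open>dt\<close> through the same expression, which cancels
          in the comparison.\<close>
        have nA: "?n t \<bullet> rep_L2 (A x) t = w t * (U \<bullet> (Q t *v v t)) + w t * ((H t *v (P\<^sub>1 *v U)) \<bullet> (G\<^sub>0 *v U))"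
          by (simp add: n Axt Qv inner_add_right herm hermP algebra_simps)
        have dt: "d t = w t * (U \<bullet> (Q' t *v U)) - w t * (\<mu> * (U \<bullet> (Q t *v U))) + 2 * (w t * (U \<bullet> (Q t *v v t)))"
          by (simp add: dteq R_def R'_def mv.scaleR_left mv.diff_left inner_diff_right algebra_simps)
        have ny: "\<bar>?n t \<bullet> y\<bar> = w t * \<bar>(H t *v (P\<^sub>1 *v U)) \<bullet> y\<bar>"
          using w_pos[of t] by (simp add: n abs_mult)
        let ?X = "(H t *v (P\<^sub>1 *v U)) \<bullet> (G\<^sub>0 *v U)" and ?Y = "\<bar>(H t *v (P\<^sub>1 *v U)) \<bullet> y\<bar>"
        \<comment> \<open>Once the common factor \<open>w t\<close> is removed, every term is
          compared with \<open>a\<^sup>2\<close>, and the choice of \<mu> closes the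
          balance.\<close>
        have "2 * L * ?Y \<le> 2 * L * (K\<^sup>2 * c * a\<^sup>2)" using 4 L by (intro mult_left_mono) auto
        with 2 3 6 have "U \<bullet> (Q' t *v U) - \<mu> * (U \<bullet> (Q t *v U)) + 2 * L * ?Y + a\<^sup>2 \<le> 2 * ?X"
          by (simp add: algebra_simps abs_le_iff)
        then have "w t * (U \<bullet> (Q' t *v U) - \<mu> * (U \<bullet> (Q t *v U)) + 2 * L * ?Y + a\<^sup>2) \<le> w t * (2 * ?X)"
          using w_pos[of t] by (intro mult_left_mono) auto
        with 5 show ?case
          unfolding dt nA y_def[symmetric] ny by (simp add: algebra_simps)
      qed
    qed
    also have "\<dots> = 2 * (mult_op N x \<bullet> A x)" by (simp add: inner_L2_rep)
    also have "integral\<^sup>L unit_lebesgue (\<lambda>t. d t + 2 * L * \<bar>?n t \<bullet> ?y t\<bar> + exp (- \<mu>) / K\<^sup>2 * (norm (?y t))\<^sup>2)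
        = u 1 \<bullet> (R 1 *v u 1) - u 0 \<bullet> (R 0 *v u 0) + 2 * L * integral\<^sup>L unit_lebesgue (\<lambda>t. \<bar>?n t \<bullet> ?y t\<bar>)
          + exp (- \<mu>) / K\<^sup>2 * (norm x)\<^sup>2"
      using d(1,2) int by (simp add: norm_L2_rep)
    finally have "2 * (mult_op N x \<bullet> A x) \<ge> u 1 \<bullet> (R 1 *v u 1) - u 0 \<bullet> (R 0 *v u 0)
        + 2 * L * integral\<^sup>L unit_lebesgue (\<lambda>t. \<bar>?n t \<bullet> ?y t\<bar>) + exp (- \<mu>) / K\<^sup>2 * (norm x)\<^sup>2" .
    moreover have "2 * L * \<bar>mult_op N x \<bullet> x\<bar> \<le> 2 * L * integral\<^sup>L unit_lebesgue (\<lambda>t. \<bar>?n t \<bullet> ?y t\<bar>)"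
      unfolding inner_L2_rep using L by (intro mult_left_mono integral_abs_bound) auto
    moreover have "u 1 \<bullet> (R 1 *v u 1) - u 0 \<bullet> (R 0 *v u 0) \<ge> - (r * (norm (boundary_values H x))\<^sup>2)"
      unfolding bv by (rule boundary_form_bound) (rule r(2), simp)+
    moreover have "r * (norm (boundary_values H x))\<^sup>2 \<le> r * (k * norm (C x))\<^sup>2"
      using r(1) k(2)[OF x] by (intro mult_left_mono power_mono) auto
    ultimately show ?thesis by (simp add: power_mult_distrib)
  qed
  note estimate = this
  define e where "e = exp (- \<mu>) / K\<^sup>2"
  show thesis
  proof (rule that[OF N N_herm])
    show "e / 2 > 0" using K_pos by (simp add: e_def)
    show "r * k\<^sup>2 / 2 \<ge> 0" using r(1) by simp
    show "mult_op N x \<bullet> A x \<ge> L * \<bar>mult_op N x \<bullet> x\<bar> + e / 2 * (norm x)\<^sup>2 - r * k\<^sup>2 / 2 * (norm (C x))\<^sup>2"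
      if "x \<in> D" for x
      using estimate[OF that] unfolding e_def[symmetric] by simp
  qed
qed

end

section \<open>Differential inequalities\<close>

lemma nondecreasing_if_derivative_nonneg:
  fixes f :: "real \<Rightarrow> real"
  assumes deriv: "\<And>t. t \<ge> 0 \<Longrightarrow> (f has_real_derivative f' t) (at t within {0..})"
    and nonneg: "\<And>t. t \<ge> 0 \<Longrightarrow> f' t \<ge> 0" and "0 \<le> a" "a \<le> b"
  shows "f a \<le> f b"
proof -
  have "\<exists>x\<in>{a..b}. f b - f a = f' x * (b - a)"
  proof (rule mvt_very_simple[OF \<open>a \<le> b\<close>])
    fix x assume "a \<le> x" "x \<le> b"
    with \<open>0 \<le> a\<close> have "(f has_real_derivative f' x) (at x within {a..b})"
      by (intro DERIV_subset[OF deriv]) auto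
    then show "(f has_derivative (*) (f' x)) (at x within {a..b})"
      by (simp add: has_field_derivative_def)
  qed
  with nonneg assms(3,4) show ?thesis by (metis atLeastAtMost_iff diff_ge_0_iff_ge mult_nonneg_nonneg order_trans)
qed

text \<open>The function \<open>j\<close> is nondecreasing with limit zero, hence nonpositive. The
  energy decays at most at rate \<open>2 * L\<close>, so the derivative of
  \<open>exp (2 * L * t) * j t\<close> is at least \<open>\<epsilon> * e 0\<close>. If that number
  were positive, a nonpositive function would grow linearly without bound.\<close>

lemma decaying_multiplier_imp_zero_energy:
  fixes j e :: "real \<Rightarrow> real"
  assumes j: "\<And>t. t \<ge> 0 \<Longrightarrow> (j has_real_derivative j' t) (at t within {0..})"
    and e: "\<And>t. t \<ge> 0 \<Longrightarrow> (e has_real_derivative e' t) (at t within {0..})"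
    and j': "\<And>t. t \<ge> 0 \<Longrightarrow> j' t \<ge> 2 * L * \<bar>j t\<bar> + \<epsilon> * e t"
    and e': "\<And>t. t \<ge> 0 \<Longrightarrow> e' t \<ge> - 2 * L * e t"
    and "\<And>t. t \<ge> 0 \<Longrightarrow> e t \<ge> 0" "\<epsilon> > 0" "L \<ge> 0" and lim: "(j \<longlongrightarrow> 0) at_top"
  shows "e 0 = 0"
proof (rule ccontr)
  assume "e 0 \<noteq> 0"
  then have "e 0 > 0" using assms(5)[of 0] by simp
  have "j' t \<ge> 0" if "t \<ge> 0" for t
  proof -
    have "0 \<le> 2 * L * \<bar>j t\<bar> + \<epsilon> * e t" using that assms(5-7) by simp
    with j'[OF that] show ?thesis by simp
  qed
  then have mono: "j a \<le> j b" if "0 \<le> a" "a \<le> b" for a b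
    using nondecreasing_if_derivative_nonneg[OF j _ that] by blast
  have j_le: "j t \<le> 0" if "t \<ge> 0" for t
    by (rule tendsto_lowerbound[OF lim])
       (use that mono in \<open>auto intro!: eventually_at_top_linorderI[of t]\<close>)
  \<comment> \<open>The integrating factor turns the lower bound on \<open>e'\<close> into
    monotonicity.\<close>
  have exp_e: "e 0 \<le> exp (2 * L * t) * e t" if "t \<ge> 0" for t
  proof -
    have "exp (2 * L * 0) * e 0 \<le> exp (2 * L * t) * e t"
    proof (rule nondecreasing_if_derivative_nonneg[OF _ _ order_refl that])
      show "((\<lambda>t. exp (2 * L * t) * e t) has_real_derivative exp (2 * L * t) * (2 * L * e t + e' t)) (at t within {0..})"
        if "t \<ge> 0" for t
        by (auto intro!: derivative_eq_intros e[OF that] simp: algebra_simps)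
      show "0 \<le> exp (2 * L * t) * (2 * L * e t + e' t)" if "t \<ge> 0" for t
        using e'[OF that] by simp
    qed
    then show ?thesis by simp
  qed
  have bound: "j 0 + \<epsilon> * e 0 * t \<le> 0" if "t \<ge> 0" for t
  proof -
    have "exp (2 * L * 0) * j 0 - \<epsilon> * e 0 * 0 \<le> exp (2 * L * t) * j t - \<epsilon> * e 0 * t"
    proof (rule nondecreasing_if_derivative_nonneg[OF _ _ order_refl that])
      fix t :: real assume t: "t \<ge> 0"
      show "((\<lambda>t. exp (2 * L * t) * j t - \<epsilon> * e 0 * t) has_real_derivative
          exp (2 * L * t) * (2 * L * j t + j' t) - \<epsilon> * e 0) (at t within {0..})"
        by (auto intro!: derivative_eq_intros j[OF t] simp: algebra_simps)
      have "2 * L * \<bar>j t\<bar> \<ge> - (2 * L * j t)" 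
        using mult_left_mono[of "- j t" "\<bar>j t\<bar>" "2 * L"] \<open>L \<ge> 0\<close> by simp
      with j'[OF t] have "\<epsilon> * e t \<le> 2 * L * j t + j' t" by simp
      then have "exp (2 * L * t) * (\<epsilon> * e t) \<le> exp (2 * L * t) * (2 * L * j t + j' t)"
        by (intro mult_left_mono) auto
      moreover have "\<epsilon> * e 0 \<le> \<epsilon> * (exp (2 * L * t) * e t)"
        using exp_e[OF t] \<open>\<epsilon> > 0\<close> by (intro mult_left_mono) auto
      moreover have "exp (2 * L * t) * (\<epsilon> * e t) = \<epsilon> * (exp (2 * L * t) * e t)" by simp
      ultimately show "0 \<le> exp (2 * L * t) * (2 * L * j t + j' t) - \<epsilon> * e 0"
        by linarith
    qed
    moreover have "exp (2 * L * t) * j t \<le> 0" using j_le[OF that] by (simp add: mult_nonneg_nonpos)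
    ultimately show ?thesis by simp
  qed
  \<comment> \<open>At this time the linear lower bound would equal \<open>1\<close>, although it
    must stay nonpositive.\<close>
  define s where "s = (1 - j 0) / (\<epsilon> * e 0)"
  have "s \<ge> 0" "\<epsilon> * e 0 * s = 1 - j 0"
    using \<open>\<epsilon> > 0\<close> \<open>e 0 > 0\<close> j_le[of 0] by (simp_all add: s_def)
  with bound[of s] show False by simp
qed

section \<open>Strongly continuous semigroups\<close>

lemma C0_semigroup_add: "C0_semigroup T \<Longrightarrow> s \<ge> 0 \<Longrightarrow> t \<ge> 0 \<Longrightarrow> T (s + t) x = T s (T t x)"
  by (simp add: C0_semigroup_def)

lemma C0_semigroup_linear: "C0_semigroup T \<Longrightarrow> t \<ge> 0 \<Longrightarrow> linear (T t)"
  by (simp add: C0_semigroup_def bounded_linear.linear)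

text \<open>The domain of a generator consists of the points where the difference quotient
  converges, so linearity is read off from limits and requires no computation with boundary
  values.\<close>

lemma generates_diff:
  assumes gen: "generates D A T" and x: "x \<in> D" and y: "y \<in> D"
  shows "x - y \<in> D" and "A (x - y) = A x - A y"
proof -
  have T: "C0_semigroup T" using gen by (simp add: generates_def)
  have lim: "((\<lambda>t. (1 / t) *\<^sub>R (T t x - x)) \<longlongrightarrow> A x) (at_right 0)" if "x \<in> D" for x
    using gen that by (auto simp: generates_def)
  have "((\<lambda>t. (1 / t) *\<^sub>R (T t x - x) - (1 / t) *\<^sub>R (T t y - y)) \<longlongrightarrow> A x - A y) (at_right 0)"
    by (intro tendsto_diff lim x y)
  moreover have "\<forall>\<^sub>F t in at_right 0. (1 / t) *\<^sub>R (T t x - x) - (1 / t) *\<^sub>R (T t y - y)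
      = (1 / t) *\<^sub>R (T t (x - y) - (x - y))"
    using eventually_at_right_less
  proof eventually_elim
    case (elim t)
    then have "bounded_linear (T t)" using T by (simp add: C0_semigroup_def)
    then have "T t (x - y) = T t x - T t y" by (intro linear_diff bounded_linear.linear)
    then show ?case by (simp add: scaleR_diff_right)
  qed
  ultimately have "((\<lambda>t. (1 / t) *\<^sub>R (T t (x - y) - (x - y))) \<longlongrightarrow> A x - A y) (at_right 0)"
    using tendsto_cong by fast
  then show "x - y \<in> D" and "A (x - y) = A x - A y"
    using gen by (auto simp: generates_def)
qed

text \<open>Applying the bounded operator \<open>T t\<close> to the difference quotient of
  \<open>x\<close> gives the difference quotient of \<open>T t x\<close>, because the semigroup is
  commutative.\<close>

lemma generates_commute:
  assumes gen: "generates D A T" and x: "x \<in> D" and t: "t \<ge> 0"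
  shows "T t x \<in> D" and "A (T t x) = T t (A x)"
proof -
  have T: "C0_semigroup T" using gen by (simp add: generates_def)
  then have bl: "bounded_linear (T t)" using t by (simp add: C0_semigroup_def)
  have "((\<lambda>h. (1 / h) *\<^sub>R (T h x - x)) \<longlongrightarrow> A x) (at_right 0)"
    using gen x by (auto simp: generates_def)
  then have "((\<lambda>h. T t ((1 / h) *\<^sub>R (T h x - x))) \<longlongrightarrow> T t (A x)) (at_right 0)"
    by (rule bounded_linear.tendsto[OF bl])
  moreover have "\<forall>\<^sub>F h in at_right 0. T t ((1 / h) *\<^sub>R (T h x - x)) = (1 / h) *\<^sub>R (T h (T t x) - T t x)"
    using eventually_at_right_less
  proof eventually_elim
    case (elim h)
    then have "T t (T h x) = T h (T t x)"
      using C0_semigroup_add[OF T, of t h x] C0_semigroup_add[OF T, of h t x] t by (simp add: add.commute)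
    then show ?case
      using linear_diff[OF bounded_linear.linear[OF bl]] linear_scale[OF bounded_linear.linear[OF bl]] by simp
  qed
  ultimately have "((\<lambda>h. (1 / h) *\<^sub>R (T h (T t x) - T t x)) \<longlongrightarrow> T t (A x)) (at_right 0)"
    using tendsto_cong by fast
  then show "T t x \<in> D" and "A (T t x) = T t (A x)"
    using gen by (auto simp: generates_def)
qed

text \<open>The operator at the smaller of the two times is factored out. Continuity from both sides
  is thus reduced to right continuity at zero.\<close>

lemma semigroup_increment_bound:
  assumes T: "C0_semigroup T" and M: "\<And>t x. t \<ge> 0 \<Longrightarrow> norm (T t x) \<le> M * norm x" and "s \<ge> 0" "t \<ge> 0"
  shows "norm (T s x - T t x) \<le> M * norm (T \<bar>s - t\<bar> x - x)"
  using \<open>s \<ge> 0\<close> \<open>t \<ge> 0\<close>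
proof (induction s t rule: linorder_wlog)
  case (le s t)
  have "T t x = T s (T (t - s) x)"
    using C0_semigroup_add[OF T, of s "t - s" x] le by simp
  moreover have "T s (T (t - s) x) - T s x = T s (T (t - s) x - x)"
    using linear_diff[OF C0_semigroup_linear[OF T]] le by simp
  ultimately have "norm (T s x - T t x) = norm (T s (T (t - s) x - x))"
    by (simp add: norm_minus_commute[of "T s x"])
  with M[of s "T (t - s) x - x"] le show ?case by simp
next
  case (sym s t)
  then show ?case by (simp add: norm_minus_commute abs_minus_commute)
qed

lemma semigroup_continuous:
  assumes T: "C0_semigroup T" and M: "\<And>t x. t \<ge> 0 \<Longrightarrow> norm (T t x) \<le> M * norm x"
  shows "continuous_on {0..} (\<lambda>t. T t x)"
  unfolding continuous_on_def
proof
  fix t :: real assume "t \<in> {0..}"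
  have lim: "((\<lambda>h. T h x) \<longlongrightarrow> x) (at_right 0)" using T by (simp add: C0_semigroup_def)
  show "((\<lambda>t. T t x) \<longlongrightarrow> T t x) (at t within {0..})"
  proof (rule Lim_null[THEN iffD2], rule Lim_null_comparison)
    show "\<forall>\<^sub>F s in at t within {0..}. norm (T s x - T t x) \<le> M * norm (T \<bar>s - t\<bar> x - x)"
      using \<open>t \<in> {0..}\<close> by (auto simp: eventually_at_filter intro!: always_eventually semigroup_increment_bound[OF T M])
    have "filterlim (\<lambda>s. \<bar>s - t\<bar>) (at_right 0) (at t within {0..})"
      by (auto simp: filterlim_at eventually_at_filter intro!: tendsto_eq_intros)
    from filterlim_compose[OF lim this]
    show "((\<lambda>s. M * norm (T \<bar>s - t\<bar> x - x)) \<longlongrightarrow> 0) (at t within {0..})"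
      by (auto intro!: tendsto_eq_intros)
  qed
qed

text \<open>A generator gives only the right derivative at zero. At \<open>t\<close> the difference
  quotient from either side is \<open>T r\<close> applied to a quotient at zero, with
  \<open>r\<close> the smaller of \<open>s\<close> and \<open>t\<close>. The error splits into that
  of the quotient and the modulus of continuity of the orbit of \<open>A x\<close>, with a uniform
  constant \<open>M\<close>.\<close>

lemma semigroup_has_vector_derivative:
  assumes gen: "generates D A T" and M: "\<And>t x. t \<ge> 0 \<Longrightarrow> norm (T t x) \<le> M * norm x"
    and x: "x \<in> D" and t: "t \<ge> 0"
  shows "((\<lambda>t. T t x) has_vector_derivative T t (A x)) (at t within {0..})"
  unfolding has_vector_derivative_def
proof (rule has_derivativeI_sandwich[OF zero_less_one])
  have T: "C0_semigroup T" using gen by (simp add: generates_def)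
  define q where "q h = (1 / h) *\<^sub>R (T h x - x)" for h
  show "bounded_linear (\<lambda>h. h *\<^sub>R T t (A x))" by (intro bounded_linear_intros)
  show "norm (T s x - T t x - (s - t) *\<^sub>R T t (A x)) / norm (s - t)
      \<le> M * norm (q \<bar>s - t\<bar> - A x) + M * norm (T \<bar>s - t\<bar> (A x) - A x)"
    if s: "s \<in> {0..}" "s \<noteq> t" for s
  proof -
    define r where "r = min s t"
    have r: "r \<ge> 0" using s t by (simp add: r_def)
    have add: "T (r + \<bar>s - t\<bar>) x = T r (T \<bar>s - t\<bar> x)" by (rule C0_semigroup_add[OF T r]) simp
    have "(1 / (s - t)) *\<^sub>R (T s x - T t x) = (1 / \<bar>s - t\<bar>) *\<^sub>R (T (r + \<bar>s - t\<bar>) x - T r x)"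
    proof (cases "s < t")
      case True
      then have "r + \<bar>s - t\<bar> = t" "r = s" "\<bar>s - t\<bar> = - (s - t)" by (auto simp: r_def)
      then show ?thesis
        by (simp only: minus_divide_right[symmetric] scaleR_minus_left scaleR_diff_right) simp
    next
      case False
      then have "r + \<bar>s - t\<bar> = s" "r = t" "\<bar>s - t\<bar> = s - t" by (auto simp: r_def)
      then show ?thesis by simp
    qed
    also have "\<dots> = T r (q \<bar>s - t\<bar>)"
      unfolding add q_def using linear_diff[OF C0_semigroup_linear[OF T r]] linear_scale[OF C0_semigroup_linear[OF T r]] by simp
    finally have quot: "(1 / (s - t)) *\<^sub>R (T s x - T t x) = T r (q \<bar>s - t\<bar>)" .
    have "norm (T s x - T t x - (s - t) *\<^sub>R T t (A x)) / norm (s - t)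
        = norm ((1 / (s - t)) *\<^sub>R (T s x - T t x - (s - t) *\<^sub>R T t (A x)))"
      by (simp add: divide_inverse mult.commute)
    also have "(1 / (s - t)) *\<^sub>R (T s x - T t x - (s - t) *\<^sub>R T t (A x)) = T r (q \<bar>s - t\<bar>) - T t (A x)"
      using s by (simp add: scaleR_diff_right quot[symmetric])
    also have "\<dots> = T r (q \<bar>s - t\<bar> - A x) + (T r (A x) - T t (A x))"
      using linear_diff[OF C0_semigroup_linear[OF T r]] by simp
    also have "norm \<dots> \<le> norm (T r (q \<bar>s - t\<bar> - A x)) + norm (T r (A x) - T t (A x))"
      by (rule norm_triangle_ineq)
    also have "\<dots> \<le> M * norm (q \<bar>s - t\<bar> - A x) + M * norm (T \<bar>s - t\<bar> (A x) - A x)"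
    proof (intro add_mono)
      show "norm (T r (q \<bar>s - t\<bar> - A x)) \<le> M * norm (q \<bar>s - t\<bar> - A x)" by (rule M[OF r])
      have "norm (T s (A x) - T t (A x)) \<le> M * norm (T \<bar>s - t\<bar> (A x) - A x)"
        using s t by (intro semigroup_increment_bound[OF T M]) auto
      moreover have "0 \<le> M * norm (T \<bar>s - t\<bar> (A x) - A x)"
        using M[of 0 "T \<bar>s - t\<bar> (A x) - A x"] by (simp add: order_trans[OF norm_ge_zero])
      \<comment> \<open>For \<open>r = t\<close> the left side is zero; for \<open>r = s\<close> the
        increment bound applies.\<close>
      ultimately show "norm (T r (A x) - T t (A x)) \<le> M * norm (T \<bar>s - t\<bar> (A x) - A x)"
        by (cases "s < t") (auto simp: r_def min_def)
    qed
    finally show ?thesis .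
  qed
  have lim: "filterlim (\<lambda>s. \<bar>s - t\<bar>) (at_right 0) (at t within {0..})"
    by (auto simp: filterlim_at eventually_at_filter intro!: tendsto_eq_intros)
  have "(q \<longlongrightarrow> A x) (at_right 0)" using gen x by (auto simp: generates_def q_def[abs_def])
  note q = filterlim_compose[OF this lim]
  have "((\<lambda>h. T h (A x)) \<longlongrightarrow> A x) (at_right 0)" using T by (simp add: C0_semigroup_def)
  note TA = filterlim_compose[OF this lim]
  show "((\<lambda>s. M * norm (q \<bar>s - t\<bar> - A x) + M * norm (T \<bar>s - t\<bar> (A x) - A x)) \<longlongrightarrow> 0) (at t within {0..})"
    by (auto intro!: tendsto_eq_intros q TA)
qed

section \<open>Trace inequality and linearity of the boundary values\<close>

lemma integral_norm_le_norm_L2: "integral\<^sup>L unit_lebesgue (\<lambda>t. norm (rep_L2 x t)) \<le> norm x"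
proof -
  define m where "m = integral\<^sup>L unit_lebesgue (\<lambda>t. norm (rep_L2 x t))"
  have int: "integrable unit_lebesgue (\<lambda>t. norm (rep_L2 x t))"
    by (intro integrable_norm square_integrable_imp_integrable square_integrable_rep_L2)
  have int2: "integrable unit_lebesgue (\<lambda>t. (norm (rep_L2 x t))\<^sup>2)"
    using square_integrable_rep_L2[of x] by (simp add: square_integrable_def)
  have int3: "integrable unit_lebesgue (\<lambda>t. m\<^sup>2)"
    by (intro continuous_imp_integrable_real continuous_intros)
  \<comment> \<open>The variance of the norm about its mean \<open>m\<close> is nonnegative, and the
    interval has measure one.\<close>
  have "0 \<le> integral\<^sup>L unit_lebesgue (\<lambda>t. (norm (rep_L2 x t) - m)\<^sup>2)" by (rule integral_nonneg_AE) simp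
  also have "(\<lambda>t. (norm (rep_L2 x t) - m)\<^sup>2) = (\<lambda>t. (norm (rep_L2 x t))\<^sup>2 - 2 * m * norm (rep_L2 x t) + m\<^sup>2)"
    by (auto simp: power2_diff algebra_simps)
  also have "integral\<^sup>L unit_lebesgue \<dots> = (norm x)\<^sup>2 - 2 * m * m + m\<^sup>2"
    using int int2 int3
    by (simp add: norm_L2_rep m_def[symmetric] measure_restrict_space)
  finally have "m\<^sup>2 \<le> (norm x)\<^sup>2" by (simp add: power2_eq_square)
  then show ?thesis unfolding m_def[symmetric] by (rule power2_le_imp_le) simp
qed

text \<open>Differentiating \<open>t *\<^sub>R u t\<close> removes the value at zero and expresses
  \<open>u 1\<close> by an integral of \<open>u\<close> and \<open>g\<close>. The value
  \<open>u 0\<close> costs one more integral of \<open>g\<close>, so altogether \<open>u\<close> is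
  counted twice and \<open>g\<close> three times.\<close>

lemma boundary_norm_bound:
  fixes u :: "real \<Rightarrow> 'a::euclidean_space"
  assumes u: "has_weak_derivative u g"
  shows "norm (u 1) + norm (u 0) \<le> integral\<^sup>L unit_lebesgue (\<lambda>t. 2 * norm (u t) + 3 * norm (g t))"
proof -
  have g: "integrable unit_lebesgue g" and u1: "u 1 = u 0 + integral\<^sup>L unit_lebesgue g"
    using u[unfolded has_weak_derivative_def, THEN conjunct1]
      u[unfolded has_weak_derivative_def, THEN conjunct2, rule_format, of 1] by simp_all
  have int_u: "integrable unit_lebesgue u"
    by (rule continuous_imp_integrable_real[OF has_weak_derivative_continuous[OF u]])
  have "has_weak_derivative (\<lambda>t. t) (\<lambda>_. 1::real)"
    by (rule has_weak_derivative_C1) (auto intro!: derivative_eq_intros)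
  then have w: "has_weak_derivative (\<lambda>t. t *\<^sub>R u t) (\<lambda>t. 1 *\<^sub>R u t + t *\<^sub>R g t)"
    by (rule has_weak_derivative_bilinear[OF bounded_bilinear_scaleR _ u])
  have int_w: "integrable unit_lebesgue (\<lambda>t. 1 *\<^sub>R u t + t *\<^sub>R g t)"
    and eq: "u 1 = integral\<^sup>L unit_lebesgue (\<lambda>t. 1 *\<^sub>R u t + t *\<^sub>R g t)"
    using w[unfolded has_weak_derivative_def, THEN conjunct1]
      w[unfolded has_weak_derivative_def, THEN conjunct2, rule_format, of 1] by simp_all
  have int: "integrable unit_lebesgue (\<lambda>t. norm (u t))" "integrable unit_lebesgue (\<lambda>t. norm (g t))"
    using g int_u by auto
  have "norm (u 1) \<le> integral\<^sup>L unit_lebesgue (\<lambda>t. norm (u t) + norm (g t))"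
    unfolding eq
  proof (rule order_trans[OF integral_norm_bound integral_mono])
    show "norm (1 *\<^sub>R u t + t *\<^sub>R g t) \<le> norm (u t) + norm (g t)" if "t \<in> space unit_lebesgue" for t
    proof -
      have "norm (1 *\<^sub>R u t + t *\<^sub>R g t) \<le> norm (u t) + \<bar>t\<bar> * norm (g t)"
        using norm_triangle_ineq[of "u t" "t *\<^sub>R g t"] by simp
      moreover have "\<bar>t\<bar> * norm (g t) \<le> norm (g t)" using that by (intro mult_left_le_one_le) auto
      ultimately show ?thesis by simp
    qed
  qed (use int int_w in auto)
  moreover have "norm (u 0) \<le> norm (u 1) + integral\<^sup>L unit_lebesgue (\<lambda>t. norm (g t))"
  proof -
    have "u 0 = u 1 - integral\<^sup>L unit_lebesgue g" by (simp add: u1)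
    then have "norm (u 0) \<le> norm (u 1) + norm (integral\<^sup>L unit_lebesgue g)"
      using norm_triangle_ineq4[of "u 1" "integral\<^sup>L unit_lebesgue g"] by simp
    also have "norm (integral\<^sup>L unit_lebesgue g) \<le> integral\<^sup>L unit_lebesgue (\<lambda>t. norm (g t))"
      by (rule integral_norm_bound)
    finally show ?thesis by simp
  qed
  ultimately show ?thesis using int by simp
qed

lemma H1_rep_diff:
  assumes "H1_rep f u g" "H1_rep f' u' g'"
  shows "H1_rep (f - f') (\<lambda>t. u t - u' t) (g - g')"
  unfolding H1_rep_def
proof (intro conjI ballI)
  have "AE t in unit_lebesgue. rep_L2 f t = u t" "AE t in unit_lebesgue. rep_L2 f' t = u' t"
    using assms unfolding H1_rep_def by blast+
  then show "AE t in unit_lebesgue. rep_L2 (f - f') t = u t - u' t"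
    using rep_L2_diff[of f f'] by eventually_elim simp
  fix t :: real assume t: "t \<in> {0..1}"
  have int: "integrable (lebesgue_on {0..t}) (rep_L2 x)" for x :: "'a L2"
    by (rule integrable_lebesgue_on_subinterval[OF square_integrable_imp_integrable[OF square_integrable_rep_L2]])
       (use t in auto)
  have "integral\<^sup>L (lebesgue_on {0..t}) (rep_L2 (g - g'))
      = integral\<^sup>L (lebesgue_on {0..t}) (\<lambda>s. rep_L2 g s - rep_L2 g' s)"
  proof (rule integral_cong_AE)
    show "AE s in lebesgue_on {0..t}. rep_L2 (g - g') s = rep_L2 g s - rep_L2 g' s"
      using rep_L2_diff[of g g'] t by (auto simp: AE_restrict_space_iff elim: eventually_mono)
  qed (use int in auto)
  also have "\<dots> = integral\<^sup>L (lebesgue_on {0..t}) (rep_L2 g) - integral\<^sup>L (lebesgue_on {0..t}) (rep_L2 g')"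
    by (rule Bochner_Integration.integral_diff[OF int int])
  moreover have "u t = u 0 + integral\<^sup>L (lebesgue_on {0..t}) (rep_L2 g)"
    "u' t = u' 0 + integral\<^sup>L (lebesgue_on {0..t}) (rep_L2 g')"
    using assms t unfolding H1_rep_def by blast+
  ultimately show "u t - u' t = u 0 - u' 0 + integral\<^sup>L (lebesgue_on {0..t}) (rep_L2 (g - g'))"
    by (simp only: algebra_simps)
qed

lemma H1_fun_diff:
  assumes "f \<in> H1" "f' \<in> H1" "t \<in> {0..1}"
  shows "H1_fun (f - f') t = H1_fun f t - H1_fun f' t"
  by (rule H1_fun_unique[OF H1_rep_diff[OF H1_rep_H1_fun H1_rep_H1_fun]]) (fact assms)+

lemma mult_op_diff: "Linfinity M \<Longrightarrow> mult_op M (x - y) = mult_op M x - mult_op M y"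
  by (intro linear_diff bounded_linear.linear bounded_linear_mult_op)

section \<open>Equivalence of the energy norm and boundedness of the output in the graph
  norm\<close>

context port_hamiltonian
begin

lemma energy_norm_sq: "(energy_norm H x)\<^sup>2 = mult_op H x \<bullet> x"
  and norm_le_energy: "(norm x)\<^sup>2 \<le> K * (mult_op H x \<bullet> x)"
  and energy_le_norm: "mult_op H x \<bullet> x \<le> K * (norm x)\<^sup>2"
proof -
  have int: "integrable unit_lebesgue (\<lambda>t. rep_L2 (mult_op H x) t \<bullet> rep_L2 x t)"
    "integrable unit_lebesgue (\<lambda>t. (norm (rep_L2 x t))\<^sup>2)"
    using square_integrable_rep_L2[of x]
    by (auto intro!: square_integrable_inner square_integrable_rep_L2 simp: square_integrable_def)
  have "integral\<^sup>L unit_lebesgue (\<lambda>t. (norm (rep_L2 x t))\<^sup>2)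
      \<le> integral\<^sup>L unit_lebesgue (\<lambda>t. K * (rep_L2 (mult_op H x) t \<bullet> rep_L2 x t))"
  proof (rule integral_mono_AE)
    show "AE t in unit_lebesgue. (norm (rep_L2 x t))\<^sup>2 \<le> K * (rep_L2 (mult_op H x) t \<bullet> rep_L2 x t)"
      using rep_mult_op[OF H_Linfinity, of x] H_lower by eventually_elim (simp add: inner_commute)
  qed (use int in auto)
  then show lower: "(norm x)\<^sup>2 \<le> K * (mult_op H x \<bullet> x)"
    by (simp add: norm_L2_rep inner_L2_rep)
  have "integral\<^sup>L unit_lebesgue (\<lambda>t. rep_L2 (mult_op H x) t \<bullet> rep_L2 x t)
      \<le> integral\<^sup>L unit_lebesgue (\<lambda>t. K * (norm (rep_L2 x t))\<^sup>2)"
  proof (rule integral_mono_AE)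
    show "AE t in unit_lebesgue. rep_L2 (mult_op H x) t \<bullet> rep_L2 x t \<le> K * (norm (rep_L2 x t))\<^sup>2"
      using rep_mult_op[OF H_Linfinity, of x] H_upper
    proof eventually_elim
      case (elim t)
      have "rep_L2 (mult_op H x) t \<bullet> rep_L2 x t \<le> norm (H t *v rep_L2 x t) * norm (rep_L2 x t)"
        unfolding elim by (rule norm_cauchy_schwarz)
      also have "\<dots> \<le> K * norm (rep_L2 x t) * norm (rep_L2 x t)"
        using elim by (intro mult_right_mono) auto
      finally show ?case by (simp add: power2_eq_square mult_ac)
    qed
  qed (use int in auto)
  then show "mult_op H x \<bullet> x \<le> K * (norm x)\<^sup>2"
    by (simp add: norm_L2_rep inner_L2_rep)
  have "0 \<le> K * (mult_op H x \<bullet> x)" using lower by (rule order_trans[OF zero_le_power2])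
  then have "0 \<le> mult_op H x \<bullet> x" using K_pos by (simp add: zero_le_mult_iff)
  then show "(energy_norm H x)\<^sup>2 = mult_op H x \<bullet> x"
    by (simp add: energy_norm_def inner_commute)
qed

text \<open>Invertibility of \<open>P\<^sub>1\<close> recovers the weak derivative of
  \<open>H x\<close> from \<open>A x\<close> and lower order terms, so the trace inequality bounds
  the boundary values by the graph norm. This yields continuity of the output along classical
  solutions.\<close>

lemma output_bound:
  obtains c where "c \<ge> 0" and "\<And>x. x \<in> D \<Longrightarrow> norm (C x) \<le> c * (norm x + norm (A x))"
proof -
  obtain w where w: "w > 0" "\<And>v. norm (hblock W\<^sub>C\<^sub>1 W\<^sub>C\<^sub>0 *v v) \<le> w * norm v" using matrix_vector_mult_bound by blast
  obtain p where p: "p > 0" "\<And>v. norm v \<le> p * norm (P\<^sub>1 *v v)"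
    using invertible_vector_bound[OF P1_invertible] by blast
  obtain g where g: "g > 0" "\<And>v. norm (G\<^sub>0 *v v) \<le> g * norm v" using matrix_vector_mult_bound by blast
  \<comment> \<open>The numbers \<open>2\<close> and \<open>3\<close> come from the trace
    inequality; \<open>c\<close> dominates the resulting coefficients of both \<open>x\<close> and
    \<open>A x\<close>.\<close>
  define c where "c = 2 * K + 3 * p * (1 + g * K)"
  have c: "c \<ge> 2 * K + 3 * p * g * K" "c \<ge> 3 * p" using p(1) g(1) K_pos by (auto simp: c_def algebra_simps)
  have "norm (boundary_values H x) \<le> c * (norm x + norm (A x))" if x: "x \<in> D" for x
  proof -
    obtain u v where u: "has_weak_derivative u v"
      and uH: "AE t in unit_lebesgue. u t = H t *v rep_L2 x t"
      and Ax: "AE t in unit_lebesgue. rep_L2 (A x) t = P\<^sub>1 *v v t + G\<^sub>0 *v u t"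
      and bv: "(norm (boundary_values H x))\<^sup>2 = (norm (u 1))\<^sup>2 + (norm (u 0))\<^sup>2"
      using domain_representatives[OF x] by blast
    have int: "integrable unit_lebesgue (\<lambda>t. norm (rep_L2 y t))" for y :: "(complex^'n) L2"
      by (intro integrable_norm square_integrable_imp_integrable square_integrable_rep_L2)
    have int_v: "integrable unit_lebesgue v" 
      using u[unfolded has_weak_derivative_def, THEN conjunct1] .
    have int_u: "integrable unit_lebesgue u"
      by (rule continuous_imp_integrable_real[OF has_weak_derivative_continuous[OF u]])
    have "(norm (boundary_values H x))\<^sup>2 \<le> (norm (u 1) + norm (u 0))\<^sup>2"
      by (simp add: bv power2_sum)
    then have "norm (boundary_values H x) \<le> norm (u 1) + norm (u 0)"
      by (rule power2_le_imp_le) simp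
    also have "\<dots> \<le> integral\<^sup>L unit_lebesgue (\<lambda>t. 2 * norm (u t) + 3 * norm (v t))"
      by (rule boundary_norm_bound[OF u])
    also have "\<dots> \<le> integral\<^sup>L unit_lebesgue (\<lambda>t. c * norm (rep_L2 x t) + c * norm (rep_L2 (A x) t))"
    proof (rule integral_mono_AE)
      show "AE t in unit_lebesgue. 2 * norm (u t) + 3 * norm (v t) \<le> c * norm (rep_L2 x t) + c * norm (rep_L2 (A x) t)"
        using uH Ax H_upper
      proof eventually_elim
        case (elim t)
        define n where "n = norm (rep_L2 x t)"
        define m where "m = norm (rep_L2 (A x) t)"
        have nu: "norm (u t) \<le> K * n" using elim by (simp add: n_def)
        have "norm (v t) \<le> p * norm (rep_L2 (A x) t - G\<^sub>0 *v u t)"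
          using p(2)[of "v t"] elim(2) by simp
        also have "\<dots> \<le> p * (m + g * norm (u t))"
          using p(1) norm_triangle_ineq4[of "rep_L2 (A x) t" "G\<^sub>0 *v u t"] g(2)[of "u t"]
          by (intro mult_left_mono) (auto simp: m_def)
        also have "\<dots> \<le> p * (m + g * (K * n))"
          using p(1) g(1) nu by (intro mult_left_mono add_left_mono) auto
        finally have "2 * norm (u t) + 3 * norm (v t) \<le> (2 * K + 3 * p * g * K) * n + 3 * p * m"
          using nu by (simp add: algebra_simps)
        also have "\<dots> \<le> c * n + c * m"
          using c by (intro add_mono mult_right_mono) (auto simp: n_def m_def)
        finally show ?case by (simp add: n_def m_def)
      qed
    qed (use int int_u int_v in auto)
    also have "\<dots> = c * integral\<^sup>L unit_lebesgue (\<lambda>t. norm (rep_L2 x t)) + c * integral\<^sup>L unit_lebesgue (\<lambda>t. norm (rep_L2 (A x) t))"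
      using int by simp
    also have "\<dots> \<le> c * norm x + c * norm (A x)"
      using c(2) p(1) by (intro add_mono mult_left_mono integral_norm_le_norm_L2) auto
    finally show ?thesis by (simp add: algebra_simps)
  qed
  note bv = this
  have "norm (C x) \<le> w * c * (norm x + norm (A x))" if x: "x \<in> D" for x
  proof -
    have "norm (C x) \<le> w * norm (boundary_values H x)" unfolding phs_output_def by (rule w)
    also have "\<dots> \<le> w * (c * (norm x + norm (A x)))" using w(1) bv[OF x] by (intro mult_left_mono) auto
    finally show ?thesis by (simp add: mult_ac)
  qed
  moreover have "w * c \<ge> 0" using w(1) c(2) p(1) by simp
  ultimately show thesis using that by blast
qed

lemma output_diff:
  assumes "x \<in> D" "y \<in> D"
  shows "C (x - y) = C x - C y"
proof -
  have "mult_op H x \<in> H1" "mult_op H y \<in> H1" using assms by (auto simp: phs_domain_def)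
  then show ?thesis
    by (simp add: phs_output_def boundary_values_def mult_op_diff[OF H_Linfinity] H1_fun_diff
        vstack_diff matrix_vector_mult_diff_distrib)
qed

end

text \<open>If the integral were zero, \<open>f\<close> would vanish almost everywhere, yet
  continuity keeps it nonzero on an interval of positive length. A right neighbourhood is taken
  since \<open>t\<close> may be zero.\<close>

lemma nn_integral_continuous_pos:
  fixes f :: "real \<Rightarrow> 'a::euclidean_space"
  assumes cont: "continuous_on {0..} f" and t: "t \<ge> 0" and nz: "f t \<noteq> 0"
  shows "(\<integral>\<^sup>+t\<in>{0..}. ennreal ((norm (f t))\<^sup>2) \<partial>lborel) > 0"
proof (rule ccontr)
  assume "\<not> ?thesis"
  then have "(\<integral>\<^sup>+t. ennreal ((norm (f t))\<^sup>2) * indicator {0..} t \<partial>lborel) = 0" by simp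
  moreover have "(\<lambda>t. ennreal ((norm (f t))\<^sup>2) * indicator {0..} t) \<in> borel_measurable lborel"
  proof -
    have "(\<lambda>t. indicator {0..} t *\<^sub>R ((norm (f t))\<^sup>2)) \<in> borel_measurable borel"
      by (intro borel_measurable_continuous_on_indicator continuous_intros cont) auto
    then have "(\<lambda>t. ennreal (indicator {0..} t *\<^sub>R ((norm (f t))\<^sup>2))) \<in> borel_measurable borel"
      by measurable
    moreover have "(\<lambda>t. ennreal ((norm (f t))\<^sup>2) * indicator {0..} t) = (\<lambda>t. ennreal (indicator {0..} t *\<^sub>R ((norm (f t))\<^sup>2)))"
      by (auto simp: indicator_def)
    ultimately show ?thesis by (simp only: measurable_lborel2)
  qed
  ultimately have ae: "AE s in lborel. s \<ge> 0 \<longrightarrow> f s = 0"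
    by (auto simp: nn_integral_0_iff_AE indicator_def elim!: eventually_mono split: if_splits)
  obtain \<delta> where \<delta>: "\<delta> > 0" "\<And>s. s \<ge> 0 \<Longrightarrow> dist s t < \<delta> \<Longrightarrow> dist (f s) (f t) < norm (f t)"
    using cont t nz unfolding continuous_on_iff by (metis atLeast_iff zero_less_norm_iff)
  have nz': "f s \<noteq> 0" if "s \<in> {t<..<t+\<delta>}" for s
    using \<delta>(2)[of s] that t by (auto simp: dist_norm)
  have "AE s in lborel. s \<notin> {t<..<t+\<delta>}"
    using ae by (rule eventually_mono) (use nz' t in auto)
  then have "{t<..<t+\<delta>} \<in> null_sets lborel" by (simp add: AE_iff_null_sets)
  then show False using \<delta>(1) by (auto simp: null_sets_def)
qed

section \<open>The Hautus inequality in a left half plane and in a strip\<close>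

context port_hamiltonian
begin

lemma energy_nonneg: "mult_op H x \<bullet> x \<ge> 0"
  unfolding energy_norm_sq[symmetric] by simp

text \<open>Pairing \<open>z = s x - A x\<close> with \<open>H x\<close> in the energy estimate
  bounds \<open>\<rho> * e\<close>, where \<rho> is the modulus of the real part of
  \<open>s\<close>. After multiplication by \<rho>, half of \<open>\<rho>\<^sup>2 * e\<close>
  absorbs the growth term with \<open>g\<close> and the mixed term with \<open>z\<close>; the other
  half is the gain.\<close>

lemma hautus_large:
  obtains R m where "R \<ge> 1" "m > 0"
    and "\<And>s x. Re s \<le> - R \<Longrightarrow> x \<in> D \<Longrightarrow>
      (energy_norm H (cscale s x - A x))\<^sup>2 + \<bar>Re s\<bar> * (norm (C x))\<^sup>2 \<ge> m * \<bar>Re s\<bar>\<^sup>2 * (energy_norm H x)\<^sup>2"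
proof -
  obtain g k where g: "g \<ge> 0" and k: "k \<ge> 0"
    and est: "\<And>x. x \<in> D \<Longrightarrow> mult_op H x \<bullet> A x \<ge> - g * (mult_op H x \<bullet> x) - k * (norm (C x))\<^sup>2"
    using energy_estimate by blast
  show thesis
  \<comment> \<open>The threshold ensures \<open>g \<le> \<rho> / 4\<close>, so the growth term
    takes only a quarter of \<open>\<rho>\<^sup>2 * e\<close>. The summand \<open>1\<close> keeps
    \<rho> positive and the threshold at least one.\<close>
  proof (rule that[of "4 * g + 1" "1 / (2 * (k + 1))"])
    fix s x assume s: "Re s \<le> - (4 * g + 1)" and x: "x \<in> D"
    define \<rho> where "\<rho> = \<bar>Re s\<bar>"
    define z where "z = cscale s x - A x"
    define e where "e = mult_op H x \<bullet> x"
    define ez where "ez = mult_op H z \<bullet> z"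
    define xz where "xz = mult_op H x \<bullet> z"
    have \<rho>: "\<rho> \<ge> 4 * g" "\<rho> > 0" "Re s = - \<rho>" using s g by (auto simp: \<rho>_def)
    have "mult_op H x \<bullet> A x = - \<rho> * e - xz"
      using inner_mult_op_cscale[OF H_Linfinity H_hermitian, of x s]
      by (simp add: xz_def z_def e_def inner_diff_right \<rho>(3))
    with est[OF x] have "\<rho> * e \<le> g * e + k * (norm (C x))\<^sup>2 - xz" by (simp add: e_def)
    then have "\<rho> * (\<rho> * e) \<le> \<rho> * (g * e + k * (norm (C x))\<^sup>2 - xz)"
      using \<rho>(2) by (intro mult_left_mono) auto
    \<comment> \<open>Young's inequality for the energy inner product, obtained by expanding the
      energy of \<open>(\<rho> / 2) *\<^sub>R x + z\<close>.\<close>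
    moreover have "0 \<le> \<rho>\<^sup>2 / 4 * e + \<rho> * xz + ez"
    proof -
      have "0 \<le> mult_op H ((\<rho> / 2) *\<^sub>R x + z) \<bullet> ((\<rho> / 2) *\<^sub>R x + z)" by (rule energy_nonneg)
      also have "\<dots> = \<rho>\<^sup>2 / 4 * e + \<rho> * xz + ez"
        using inner_mult_op_commute[OF H_Linfinity H_hermitian, of z x]
        by (simp add: mult_op_add[OF H_Linfinity] mult_op_scaleR[OF H_Linfinity] inner_add_left inner_add_right
            e_def xz_def ez_def inner_commute[of z] power2_eq_square algebra_simps)
      finally show ?thesis .
    qed
    moreover have "\<rho> * (g * e) \<le> \<rho> * (\<rho> / 4 * e)"
      using \<rho> energy_nonneg[of x] by (intro mult_left_mono mult_right_mono) (auto simp: e_def)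
    ultimately have "\<rho>\<^sup>2 / 2 * e \<le> k * (\<rho> * (norm (C x))\<^sup>2) + ez"
      by (simp add: power2_eq_square algebra_simps)
    also have "\<dots> \<le> (k + 1) * (ez + \<rho> * (norm (C x))\<^sup>2)"
      using k \<rho>(2) energy_nonneg[of z] by (simp add: algebra_simps ez_def)
    finally have "\<rho>\<^sup>2 * e / (2 * (k + 1)) \<le> ez + \<rho> * (norm (C x))\<^sup>2"
      using k by (simp add: divide_le_eq algebra_simps)
    then show "(energy_norm H (cscale s x - A x))\<^sup>2 + \<bar>Re s\<bar> * (norm (C x))\<^sup>2
        \<ge> 1 / (2 * (k + 1)) * \<bar>Re s\<bar>\<^sup>2 * (energy_norm H x)\<^sup>2"
      by (simp add: energy_norm_sq \<rho>_def[symmetric] e_def ez_def z_def)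
  qed (use g k in auto)
qed

text \<open>The multiplier estimate is used with \<open>L = R\<close>, so that \<open>Re s\<close>
  times the form of \<open>N\<close>, whose sign is unknown, is absorbed. This bounds the energy by
  the squared output and the energy of \<open>z\<close> with a constant independent of
  \<open>s\<close>; the powers of the real part are inserted at the end, where they are
  bounded.\<close>

lemma hautus_strip:
  assumes R: "R \<ge> 1"
  obtains m where "m > 0"
    and "\<And>s x. - R \<le> Re s \<Longrightarrow> Re s < 0 \<Longrightarrow> x \<in> D \<Longrightarrow>
      (energy_norm H (cscale s x - A x))\<^sup>2 + \<bar>Re s\<bar> * (norm (C x))\<^sup>2 \<ge> m * \<bar>Re s\<bar>\<^sup>2 * (energy_norm H x)\<^sup>2"
proof -
  obtain N \<epsilon> k where N: "Linfinity N" "AE t in unit_lebesgue. hermitian (N t)" and \<epsilon>: "\<epsilon> > 0" and k: "k \<ge> 0"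
    and est: "\<And>x. x \<in> D \<Longrightarrow> mult_op N x \<bullet> A x
           \<ge> R * \<bar>mult_op N x \<bullet> x\<bar> + \<epsilon> * (norm x)\<^sup>2 - k * (norm (C x))\<^sup>2"
    using multiplier_estimate[of R] R by auto
  obtain B where B: "B > 0" "\<And>x. norm (mult_op N x) \<le> norm x * B"
    using bounded_linear.pos_bounded[OF bounded_linear_mult_op[OF N(1)]] by blast
  \<comment> \<open>The factor \<open>2 / \<epsilon>\<close> undoes the half of \<epsilon> left
    after Young's inequality, \<open>K\<close> passes from the norm to the energy, and the last
    summand collects Young's constant and the passage from the norm of \<open>z\<close> to its
    energy.\<close>
  define M where "M = 2 * K / \<epsilon> * (k + B\<^sup>2 * K / (2 * \<epsilon>))"
  have M: "M > 0" using \<epsilon> k B(1) K_pos unfolding M_def by (intro mult_pos_pos add_nonneg_pos) auto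
  show thesis
  proof (rule that[of "1 / (M * R\<^sup>2)"])
    show "1 / (M * R\<^sup>2) > 0" using M R by simp
    fix s x assume s: "- R \<le> Re s" "Re s < 0" and x: "x \<in> D"
    define \<rho> where "\<rho> = \<bar>Re s\<bar>"
    define z where "z = cscale s x - A x"
    define e where "e = mult_op H x \<bullet> x"
    define ez where "ez = mult_op H z \<bullet> z"
    define c where "c = (norm (C x))\<^sup>2"
    have nonneg: "ez \<ge> 0" "c \<ge> 0" by (simp_all add: ez_def energy_nonneg c_def)
    have \<rho>: "\<rho> > 0" "\<rho> \<le> R" using s by (auto simp: \<rho>_def)
    have "mult_op N x \<bullet> A x = Re s * (mult_op N x \<bullet> x) - mult_op N x \<bullet> z"
      using inner_mult_op_cscale[OF N, of x s] by (simp add: z_def inner_diff_right)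
    moreover have "Re s * (mult_op N x \<bullet> x) \<le> R * \<bar>mult_op N x \<bullet> x\<bar>"
    proof -
      have "Re s * (mult_op N x \<bullet> x) \<le> \<rho> * \<bar>mult_op N x \<bullet> x\<bar>"
        unfolding \<rho>_def abs_mult[symmetric] by (rule abs_ge_self)
      also have "\<dots> \<le> R * \<bar>mult_op N x \<bullet> x\<bar>" using \<rho> by (intro mult_right_mono) auto
      finally show ?thesis .
    qed
    moreover have "- (mult_op N x \<bullet> z) \<le> B * norm x * norm z"
    proof -
      have "- (mult_op N x \<bullet> z) \<le> norm (mult_op N x) * norm z"
        using Cauchy_Schwarz_ineq2[of "mult_op N x" z] by linarith
      also have "\<dots> \<le> norm x * B * norm z" by (intro mult_right_mono B) auto
      finally show ?thesis by (simp add: mult_ac)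
    qed
    moreover have "B * norm x * norm z \<le> \<epsilon> / 2 * (norm x)\<^sup>2 + B\<^sup>2 / (2 * \<epsilon>) * (norm z)\<^sup>2"
    proof -
      have "0 \<le> (\<epsilon> * norm x - B * norm z)\<^sup>2 / (2 * \<epsilon>)" using \<epsilon> by simp
      also have "\<dots> = \<epsilon> / 2 * (norm x)\<^sup>2 + B\<^sup>2 / (2 * \<epsilon>) * (norm z)\<^sup>2 - B * norm x * norm z"
        using \<epsilon> by (simp add: power2_eq_square field_simps)
      finally show ?thesis by simp
    qed
    ultimately have "\<epsilon> / 2 * (norm x)\<^sup>2 \<le> k * c + B\<^sup>2 / (2 * \<epsilon>) * (norm z)\<^sup>2"
      using est[OF x] by (simp add: c_def)
    also have "\<dots> \<le> k * c + B\<^sup>2 / (2 * \<epsilon>) * (K * ez)"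
      unfolding ez_def using \<epsilon> norm_le_energy[of z] by (intro add_left_mono mult_left_mono) auto
    also have "\<dots> \<le> (k + B\<^sup>2 * K / (2 * \<epsilon>)) * (c + ez)"
    proof -
      define b where "b = B\<^sup>2 * K / (2 * \<epsilon>)"
      have "B\<^sup>2 / (2 * \<epsilon>) * (K * ez) = b * ez" and "b \<ge> 0" using \<epsilon> K_pos by (simp_all add: b_def)
      then show ?thesis unfolding b_def[symmetric] using k nonneg by (simp add: algebra_simps)
    qed
    finally have n: "\<epsilon> / 2 * (norm x)\<^sup>2 \<le> (k + B\<^sup>2 * K / (2 * \<epsilon>)) * (c + ez)" .
    have "e \<le> 2 * K / \<epsilon> * (\<epsilon> / 2 * (norm x)\<^sup>2)"
      using energy_le_norm[of x] \<epsilon> by (simp add: e_def)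
    also have "\<dots> \<le> 2 * K / \<epsilon> * ((k + B\<^sup>2 * K / (2 * \<epsilon>)) * (c + ez))"
      using n K_pos \<epsilon> by (intro mult_left_mono) auto
    also have "\<dots> = M * (c + ez)" by (simp add: M_def)
    finally have e: "e \<le> M * (c + ez)" .
    have "\<rho>\<^sup>2 * e \<le> \<rho>\<^sup>2 * (M * (c + ez))" using e by (intro mult_left_mono) auto
    also have "\<dots> = M * (\<rho>\<^sup>2 * c + \<rho>\<^sup>2 * ez)" by (simp add: algebra_simps)
    also have "\<dots> \<le> M * (R\<^sup>2 * (\<rho> * c) + R\<^sup>2 * ez)"
    proof (intro mult_left_mono add_mono)
      \<comment> \<open>The output carries only one power of \<rho>. The second is bounded by
        \<open>R\<close>, and \<open>R \<ge> 1\<close> allows the common constant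
        \<open>R\<^sup>2\<close>.\<close>
      have "\<rho> * \<rho> \<le> R * R * \<rho>"
        using \<rho> R by (intro mult_right_mono) (auto intro: order_trans[OF \<rho>(2)] simp: mult_le_cancel_left1)
      then show "\<rho>\<^sup>2 * c \<le> R\<^sup>2 * (\<rho> * c)"
        using mult_right_mono[OF _ nonneg(2), of "\<rho> * \<rho>" "R * R * \<rho>"] by (simp add: power2_eq_square mult_ac)
      show "\<rho>\<^sup>2 * ez \<le> R\<^sup>2 * ez" using \<rho> nonneg by (intro mult_right_mono power_mono) auto
    qed (use M in auto)
    finally have "\<rho>\<^sup>2 * e \<le> (M * R\<^sup>2) * (ez + \<rho> * c)" by (simp add: algebra_simps)
    then have "\<rho>\<^sup>2 * e / (M * R\<^sup>2) \<le> ez + \<rho> * c"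
      using M R by (simp add: divide_le_eq mult.commute)
    then show "(energy_norm H (cscale s x - A x))\<^sup>2 + \<bar>Re s\<bar> * (norm (C x))\<^sup>2
        \<ge> 1 / (M * R\<^sup>2) * \<bar>Re s\<bar>\<^sup>2 * (energy_norm H x)\<^sup>2"
      by (simp add: energy_norm_sq \<rho>_def[symmetric] e_def ez_def z_def c_def)
  qed
qed

theorem hautus_test:
  "\<exists>m>0. \<forall>s. Re s < 0 \<longrightarrow> (\<forall>x\<in>D. (energy_norm H (cscale s x - A x))\<^sup>2 + \<bar>Re s\<bar> * (norm (C x))\<^sup>2
     \<ge> m * \<bar>Re s\<bar>\<^sup>2 * (energy_norm H x)\<^sup>2)"
proof -
  obtain R m where R: "R \<ge> 1" and m: "m > 0"
    and large: "\<And>s x. Re s \<le> - R \<Longrightarrow> x \<in> D \<Longrightarrow>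
      (energy_norm H (cscale s x - A x))\<^sup>2 + \<bar>Re s\<bar> * (norm (C x))\<^sup>2 \<ge> m * \<bar>Re s\<bar>\<^sup>2 * (energy_norm H x)\<^sup>2"
    using hautus_large by blast
  obtain m' where m': "m' > 0"
    and strip: "\<And>s x. - R \<le> Re s \<Longrightarrow> Re s < 0 \<Longrightarrow> x \<in> D \<Longrightarrow>
      (energy_norm H (cscale s x - A x))\<^sup>2 + \<bar>Re s\<bar> * (norm (C x))\<^sup>2 \<ge> m' * \<bar>Re s\<bar>\<^sup>2 * (energy_norm H x)\<^sup>2"
    using hautus_strip[OF R] by blast
  have "(energy_norm H (cscale s x - A x))\<^sup>2 + \<bar>Re s\<bar> * (norm (C x))\<^sup>2
      \<ge> min m m' * \<bar>Re s\<bar>\<^sup>2 * (energy_norm H x)\<^sup>2" if "Re s < 0" "x \<in> D" for s x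
  proof -
    have "min m m' * (\<bar>Re s\<bar>\<^sup>2 * (energy_norm H x)\<^sup>2) \<le> m * (\<bar>Re s\<bar>\<^sup>2 * (energy_norm H x)\<^sup>2)"
      "min m m' * (\<bar>Re s\<bar>\<^sup>2 * (energy_norm H x)\<^sup>2) \<le> m' * (\<bar>Re s\<bar>\<^sup>2 * (energy_norm H x)\<^sup>2)"
      by (intro mult_right_mono; simp)+
    moreover have "m * (\<bar>Re s\<bar>\<^sup>2 * (energy_norm H x)\<^sup>2) \<le> (energy_norm H (cscale s x - A x))\<^sup>2 + \<bar>Re s\<bar> * (norm (C x))\<^sup>2
      \<or> m' * (\<bar>Re s\<bar>\<^sup>2 * (energy_norm H x)\<^sup>2) \<le> (energy_norm H (cscale s x - A x))\<^sup>2 + \<bar>Re s\<bar> * (norm (C x))\<^sup>2"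
      using large[of s x] strip[of s x] that unfolding mult.assoc by linarith
    ultimately show ?thesis unfolding mult.assoc by linarith
  qed
  with m m' show ?thesis by (intro exI[of _ "min m m'"]) auto
qed

section \<open>Approximate observability\<close>

lemma exponentially_stable_norm_bound:
  assumes "exponentially_stable H T"
  obtains M \<omega> where "M \<ge> 0" "\<omega> > 0" "\<And>t x. t \<ge> 0 \<Longrightarrow> norm (T t x) \<le> M * exp (- \<omega> * t) * norm x"
proof -
  obtain M \<omega> where M: "M \<ge> 1" "\<omega> > 0"
    and st: "\<And>t x. t \<ge> 0 \<Longrightarrow> energy_norm H (T t x) \<le> M * exp (- \<omega> * t) * energy_norm H x"
    using assms unfolding exponentially_stable_def by blast
  have nonneg: "energy_norm H x \<ge> 0" for x
    using energy_nonneg[of x] by (simp add: energy_norm_def inner_commute)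
  have 1: "norm x \<le> sqrt K * energy_norm H x" for x
    by (rule power2_le_imp_le) (use norm_le_energy[of x] K_pos nonneg[of x] in \<open>auto simp: power_mult_distrib energy_norm_sq\<close>)
  have 2: "energy_norm H x \<le> sqrt K * norm x" for x
    by (rule power2_le_imp_le) (use energy_le_norm[of x] K_pos in \<open>auto simp: power_mult_distrib energy_norm_sq\<close>)
  have "norm (T t x) \<le> (K * M) * exp (- \<omega> * t) * norm x" if "t \<ge> 0" for t x
  proof -
    have "norm (T t x) \<le> sqrt K * energy_norm H (T t x)" by (rule 1)
    also have "\<dots> \<le> sqrt K * (M * exp (- \<omega> * t) * energy_norm H x)"
      using K_pos st[OF that] by (intro mult_left_mono) auto
    also have "\<dots> \<le> sqrt K * (M * exp (- \<omega> * t) * (sqrt K * norm x))"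
      using K_pos M 2 by (intro mult_left_mono) auto
    also have "\<dots> = (sqrt K * sqrt K * M) * exp (- \<omega> * t) * norm x" by (simp add: mult_ac)
    finally show ?thesis using K_pos by simp
  qed
  with M K_pos show thesis by (intro that[of "K * M" \<omega>]) auto
qed

text \<open>The graph norm bound is applied to \<open>T s x - T t x\<close>. Since \<open>A\<close>
  commutes with the semigroup, both parts of its graph norm are increments of orbits, namely those
  of \<open>x\<close> and \<open>A x\<close>.\<close>

lemma output_continuous:
  assumes gen: "generates D A T" and M: "\<And>t x. t \<ge> 0 \<Longrightarrow> norm (T t x) \<le> M * norm x" and x: "x \<in> D"
  shows "continuous_on {0..} (\<lambda>t. C (T t x))"
proof -
  have T: "C0_semigroup T" using gen by (simp add: generates_def)
  obtain c where c: "c \<ge> 0" "\<And>x. x \<in> D \<Longrightarrow> norm (C x) \<le> c * (norm x + norm (A x))"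
    using output_bound by blast
  have bound: "norm (C (T s x) - C (T t x)) \<le> c * (norm (T s x - T t x) + norm (T s (A x) - T t (A x)))"
    if "s \<ge> 0" "t \<ge> 0" for s t
    using c(2)[OF generates_diff(1)[OF gen generates_commute(1)[OF gen x that(1)] generates_commute(1)[OF gen x that(2)]]]
    by (simp add: output_diff generates_diff(2)[OF gen] generates_commute[OF gen x] that)
  show ?thesis
    unfolding continuous_on_def
  proof
    fix t :: real assume t: "t \<in> {0..}"
    have lim: "((\<lambda>s. T s y) \<longlongrightarrow> T t y) (at t within {0..})" for y
      using semigroup_continuous[OF T M] t by (simp add: continuous_on_def)
    show "((\<lambda>t. C (T t x)) \<longlongrightarrow> C (T t x)) (at t within {0..})"
    proof (rule Lim_null[THEN iffD2], rule Lim_null_comparison)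
      show "\<forall>\<^sub>F s in at t within {0..}. norm (C (T s x) - C (T t x))
          \<le> c * (norm (T s x - T t x) + norm (T s (A x) - T t (A x)))"
        using t bound by (auto simp: eventually_at_filter intro!: always_eventually)
      show "((\<lambda>s. c * (norm (T s x - T t x) + norm (T s (A x) - T t (A x)))) \<longlongrightarrow> 0) (at t within {0..})"
        by (auto intro!: tendsto_eq_intros lim)
    qed
  qed
qed

text \<open>The symmetry of \<open>N\<close> makes the two terms of the product rule equal. It
  serves both the energy and the multiplier.\<close>

lemma form_has_derivative:
  assumes gen: "generates D A T" and M: "\<And>t x. t \<ge> 0 \<Longrightarrow> norm (T t x) \<le> M * norm x"
    and N: "Linfinity N" "AE t in unit_lebesgue. hermitian (N t)" and x: "x \<in> D" and t: "t \<ge> 0"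
  shows "((\<lambda>t. mult_op N (T t x) \<bullet> T t x) has_real_derivative 2 * (mult_op N (T t x) \<bullet> A (T t x))) (at t within {0..})"
proof -
  have d: "((\<lambda>t. T t x) has_vector_derivative T t (A x)) (at t within {0..})"
    by (rule semigroup_has_vector_derivative[OF gen M x t])
  have dN: "((\<lambda>t. mult_op N (T t x)) has_vector_derivative mult_op N (T t (A x))) (at t within {0..})"
    by (rule bounded_linear.has_vector_derivative[OF bounded_linear_mult_op[OF N(1)] d])
  have "((\<lambda>t. mult_op N (T t x) \<bullet> T t x) has_vector_derivative
      (mult_op N (T t x) \<bullet> T t (A x) + mult_op N (T t (A x)) \<bullet> T t x)) (at t within {0..})"
    by (rule bounded_bilinear.has_vector_derivative[OF bounded_bilinear_inner dN d])
  moreover have "mult_op N (T t (A x)) \<bullet> T t x = mult_op N (T t x) \<bullet> T t (A x)"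
    by (simp add: inner_mult_op_commute[OF N] inner_commute)
  ultimately show ?thesis
    by (simp add: has_real_derivative_iff_has_vector_derivative generates_commute(2)[OF gen x t])
qed

text \<open>With zero output both estimates become differential inequalities along the orbit.
  Exponential stability sends the form of \<open>N\<close> to zero, as required by the scalar
  argument.\<close>

lemma zero_output_imp_zero:
  assumes gen: "generates D A T" and st: "exponentially_stable H T"
    and x: "x \<in> D" and zero: "\<And>t. t \<ge> 0 \<Longrightarrow> C (T t x) = 0"
  shows "x = 0"
proof -
  have T: "C0_semigroup T" using gen by (simp add: generates_def)
  obtain M \<omega> where M: "M \<ge> 0" "\<omega> > 0" and decay: "\<And>t x. t \<ge> 0 \<Longrightarrow> norm (T t x) \<le> M * exp (- \<omega> * t) * norm x"
    using exponentially_stable_norm_bound[OF st] by blast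
  have bounded: "norm (T t x) \<le> M * norm x" if "t \<ge> 0" for t x
  proof -
    have "M * exp (- \<omega> * t) * norm x \<le> M * 1 * norm x"
      using M that by (intro mult_right_mono mult_left_mono) auto
    with decay[OF that, of x] show ?thesis by simp
  qed
  obtain g k where g: "g \<ge> 0" "k \<ge> 0"
    and energy: "\<And>x. x \<in> D \<Longrightarrow> mult_op H x \<bullet> A x \<ge> - g * (mult_op H x \<bullet> x) - k * (norm (C x))\<^sup>2"
    using energy_estimate by blast
  obtain N \<epsilon> k' where N: "Linfinity N" "AE t in unit_lebesgue. hermitian (N t)" and \<epsilon>: "\<epsilon> > 0" and k': "k' \<ge> 0"
    \<comment> \<open>The rate \<open>g\<close> of the energy estimate is fixed first and then
      prescribed as \<open>L\<close>, so that one constant serves in both differential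
      inequalities.\<close>
    and mult: "\<And>x. x \<in> D \<Longrightarrow> mult_op N x \<bullet> A x
           \<ge> g * \<bar>mult_op N x \<bullet> x\<bar> + \<epsilon> * (norm x)\<^sup>2 - k' * (norm (C x))\<^sup>2"
    using multiplier_estimate[OF g(1)] by blast
  obtain B where B: "B > 0" "\<And>x. norm (mult_op N x) \<le> norm x * B"
    using bounded_linear.pos_bounded[OF bounded_linear_mult_op[OF N(1)]] by blast
  have D: "T t x \<in> D" if "t \<ge> 0" for t by (rule generates_commute(1)[OF gen x that])
  have "mult_op H (T 0 x) \<bullet> T 0 x = 0"
  proof (rule decaying_multiplier_imp_zero_energy[where L = g and \<epsilon> = "2 * \<epsilon> / K"
        and j = "\<lambda>t. mult_op N (T t x) \<bullet> T t x" and e = "\<lambda>t. mult_op H (T t x) \<bullet> T t x"])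
    fix t :: real assume t: "t \<ge> 0"
    show "((\<lambda>t. mult_op N (T t x) \<bullet> T t x) has_real_derivative 2 * (mult_op N (T t x) \<bullet> A (T t x))) (at t within {0..})"
      by (rule form_has_derivative[OF gen bounded N x t])
    show "((\<lambda>t. mult_op H (T t x) \<bullet> T t x) has_real_derivative 2 * (mult_op H (T t x) \<bullet> A (T t x))) (at t within {0..})"
      by (rule form_has_derivative[OF gen bounded H_Linfinity H_hermitian x t])
    show "- 2 * g * (mult_op H (T t x) \<bullet> T t x) \<le> 2 * (mult_op H (T t x) \<bullet> A (T t x))"
      using energy[OF D[OF t]] zero[OF t] by simp
    \<comment> \<open>The multiplier estimate gains the squared norm, while the scalar argument
      compares with the energy; this is the origin of the factor
      \<open>2 * \<epsilon> / K\<close>.\<close>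
    have "\<epsilon> / K * (mult_op H (T t x) \<bullet> T t x) \<le> \<epsilon> / K * (K * (norm (T t x))\<^sup>2)"
      using \<epsilon> K_pos energy_le_norm by (intro mult_left_mono) auto
    then have "\<epsilon> / K * (mult_op H (T t x) \<bullet> T t x) \<le> \<epsilon> * (norm (T t x))\<^sup>2" using K_pos by simp
    then show "2 * g * \<bar>mult_op N (T t x) \<bullet> T t x\<bar> + 2 * \<epsilon> / K * (mult_op H (T t x) \<bullet> T t x)
        \<le> 2 * (mult_op N (T t x) \<bullet> A (T t x))"
      using mult[OF D[OF t]] zero[OF t] by simp
    show "0 \<le> mult_op H (T t x) \<bullet> T t x" by (rule energy_nonneg)
  next
    have "((\<lambda>t. B * (M * exp (- \<omega> * t) * norm x)\<^sup>2) \<longlongrightarrow> B * (M * 0 * norm x)\<^sup>2) at_top"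
    proof (intro tendsto_intros)
      have "filterlim (\<lambda>t. - \<omega> * t) at_bot at_top"
        using M(2) by (intro filterlim_tendsto_neg_mult_at_bot[OF tendsto_const]) (auto simp: filterlim_ident)
      then show "((\<lambda>t. exp (- \<omega> * t)) \<longlongrightarrow> 0) at_top" by (rule filterlim_compose[OF exp_at_bot])
    qed
    then have lim: "((\<lambda>t. B * (M * exp (- \<omega> * t) * norm x)\<^sup>2) \<longlongrightarrow> 0) at_top" by simp
    show "((\<lambda>t. mult_op N (T t x) \<bullet> T t x) \<longlongrightarrow> 0) at_top"
    proof (rule Lim_null_comparison[OF _ lim], rule eventually_at_top_linorderI)
      fix t :: real assume t: "t \<ge> 0"
      have "norm (mult_op N (T t x) \<bullet> T t x) \<le> norm (mult_op N (T t x)) * norm (T t x)"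
        using Cauchy_Schwarz_ineq2 by simp
      also have "\<dots> \<le> (norm (T t x) * B) * norm (T t x)" by (intro mult_right_mono B) auto
      also have "\<dots> = B * (norm (T t x))\<^sup>2" by (simp add: power2_eq_square mult_ac)
      also have "\<dots> \<le> B * (M * exp (- \<omega> * t) * norm x)\<^sup>2"
        using B(1) decay[OF t, of x] by (intro mult_left_mono power_mono) auto
      finally show "norm (mult_op N (T t x) \<bullet> T t x) \<le> B * (M * exp (- \<omega> * t) * norm x)\<^sup>2" .
    qed
  qed (use \<epsilon> K_pos g in auto)
  moreover have "T 0 x = x" using T by (simp add: C0_semigroup_def)
  ultimately show ?thesis using norm_le_energy[of x] by simp
qed

theorem approximately_observable:
  assumes gen: "generates D A T" and st: "exponentially_stable H T" and x: "x \<in> D" "x \<noteq> 0"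
  shows "(\<integral>\<^sup>+t\<in>{0..}. ennreal ((norm (C (T t x)))\<^sup>2) \<partial>lborel) > 0"
proof -
  obtain M \<omega> where M: "M \<ge> 0" "\<omega> > 0" and decay: "\<And>t x. t \<ge> 0 \<Longrightarrow> norm (T t x) \<le> M * exp (- \<omega> * t) * norm x"
    using exponentially_stable_norm_bound[OF st] by blast
  have bounded: "norm (T t x) \<le> M * norm x" if "t \<ge> 0" for t x
  proof -
    have "M * exp (- \<omega> * t) * norm x \<le> M * 1 * norm x"
      using M that by (intro mult_right_mono mult_left_mono) auto
    with decay[OF that, of x] show ?thesis by simp
  qed
  obtain t where "t \<ge> 0" "C (T t x) \<noteq> 0"
    using zero_output_imp_zero[OF gen st x(1)] x(2) by blast
  then show ?thesis
    using output_continuous[OF gen bounded x(1)] by (intro nn_integral_continuous_pos) auto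
qed

end

section \<open>Reduction of the assumptions to the port-Hamiltonian setting\<close>

theorem mainTheorem2:
  fixes P\<^sub>1 G\<^sub>0 W\<^sub>B\<^sub>1 W\<^sub>B\<^sub>0 W\<^sub>C\<^sub>1 W\<^sub>C\<^sub>0 :: "complex^'n^'n"
    and H S \<Delta> :: "real \<Rightarrow> complex^'n^'n"
    and T T\<^sub>0 :: "real \<Rightarrow> (complex^'n) L2 \<Rightarrow> (complex^'n) L2"
  defines "D \<equiv> phs_domain W\<^sub>B\<^sub>1 W\<^sub>B\<^sub>0 H"
    and "A \<equiv> phs_operator P\<^sub>1 G\<^sub>0 H"
    and "C \<equiv> phs_output W\<^sub>C\<^sub>1 W\<^sub>C\<^sub>0 H"
  assumes "hermitian P\<^sub>1" and "invertible P\<^sub>1"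
    and "rank (hblock W\<^sub>B\<^sub>1 W\<^sub>B\<^sub>0) = CARD('n)"
    and "rank (hblock W\<^sub>C\<^sub>1 W\<^sub>C\<^sub>0) = CARD('n)"
    and "AE \<zeta> in lebesgue_on {0..1}. positive_hermitian (H \<zeta>)"
    and "Linfinity H" and "Linfinity (\<lambda>\<zeta>. matrix_inv (H \<zeta>))"
    and "AE \<zeta> in lebesgue_on {0..1}. diagonal_matrix (\<Delta> \<zeta>) \<and> invertible (S \<zeta>) \<and>
           P\<^sub>1 ** H \<zeta> = matrix_inv (S \<zeta>) ** \<Delta> \<zeta> ** S \<zeta>"
    and "C1_on_interval 0 1 (\<lambda>\<zeta>. matrix_inv (S \<zeta>))"
    and "C1_on_interval 0 1 S" and "C1_on_interval 0 1 \<Delta>"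
    and "generates D A T"
    and "invertible (vstack (hblock W\<^sub>B\<^sub>1 W\<^sub>B\<^sub>0) (hblock W\<^sub>C\<^sub>1 W\<^sub>C\<^sub>0))"
    and "exponentially_stable H T"
    and "generates D (\<lambda>x. A x - mult_op (\<lambda>\<zeta>. re_part G\<^sub>0 ** H \<zeta>) x) T\<^sub>0"
    and "strongly_stable H T\<^sub>0"
  shows "(\<exists>m>0. \<forall>s. Re s < 0 \<longrightarrow> (\<forall>x\<in>D.
            (energy_norm H (cscale s x - A x))\<^sup>2 + \<bar>Re s\<bar> * (norm (C x))\<^sup>2
              \<ge> m * \<bar>Re s\<bar>\<^sup>2 * (energy_norm H x)\<^sup>2))
       \<and> (\<forall>x\<^sub>0\<in>D. x\<^sub>0 \<noteq> 0 \<longrightarrow>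
            (\<integral>\<^sup>+t\<in>{0..}. ennreal ((norm (C (T t x\<^sub>0)))\<^sup>2) \<partial>lborel) > 0)"
proof -
  obtain B where B: "AE t in unit_lebesgue. norm (H t) \<le> B"
    using assms(9) by (auto simp: Linfinity_def)
  obtain B' where B': "AE t in unit_lebesgue. norm (matrix_inv (H t)) \<le> B'"
    using assms(10) by (auto simp: Linfinity_def)
  obtain c where c: "c > 0" "\<And>M v. norm ((M :: complex^'n^'n) *v v) \<le> norm M * norm v * c"
    using bounded_bilinear.pos_bounded[OF bounded_bilinear_matrix_vector_mult] by blast
  \<comment> \<open>One constant bounds both \<open>H\<close> and its inverse pointwise; the maximum
    with \<open>1\<close> makes it positive.\<close>
  define K where "K = c * max 1 (max B B')"
  have K: "K > 0" using c(1) by (simp add: K_def)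
  have le_K: "norm (M *v v) \<le> K * norm v" if "norm M \<le> max B B'" for M :: "complex^'n^'n" and v
  proof -
    have "norm (M *v v) \<le> norm M * (norm v * c)" using c(2)[of M v] by (simp add: mult.assoc)
    also have "\<dots> \<le> max 1 (max B B') * (norm v * c)" using that c(1) by (intro mult_right_mono) auto
    finally show ?thesis by (simp add: K_def mult_ac)
  qed
  obtain S' Si' \<Delta>' where S': "\<And>t. t \<in> {0..1} \<Longrightarrow> (S has_vector_derivative S' t) (at t within {0..1})" "continuous_on {0..1} S'"
    and Si': "\<And>t. t \<in> {0..1} \<Longrightarrow> ((\<lambda>t. matrix_inv (S t)) has_vector_derivative Si' t) (at t within {0..1})" "continuous_on {0..1} Si'"
    and \<Delta>': "\<And>t. t \<in> {0..1} \<Longrightarrow> (\<Delta> has_vector_derivative \<Delta>' t) (at t within {0..1})" "continuous_on {0..1} \<Delta>'"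
    using assms(12-14) unfolding C1_on_interval_def by blast
  interpret mm: bounded_bilinear "(**) :: complex^'n^'n \<Rightarrow> complex^'n^'n \<Rightarrow> complex^'n^'n"
    by (rule bounded_bilinear_matrix_matrix_mult)
  let ?Si = "\<lambda>t. matrix_inv (S t)"
  have cont: "continuous_on {0..1} S" "continuous_on {0..1} ?Si" "continuous_on {0..1} \<Delta>"
    using has_weak_derivative_continuous[OF has_weak_derivative_C1[OF S']]
      has_weak_derivative_continuous[OF has_weak_derivative_C1[OF Si']]
      has_weak_derivative_continuous[OF has_weak_derivative_C1[OF \<Delta>']] by auto
  \<comment> \<open>Solving the diagonalisation for \<open>H\<close> gives an expression that is
    continuously differentiable on the whole interval and equals \<open>H\<close> wherever the
    diagonalisation holds.\<close>
  define H\<^sub>0 where "H\<^sub>0 t = matrix_inv P\<^sub>1 ** (?Si t ** \<Delta> t ** S t)" for t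
  define H\<^sub>0' where "H\<^sub>0' t = matrix_inv P\<^sub>1 ** (?Si t ** \<Delta> t ** S' t + (?Si t ** \<Delta>' t + Si' t ** \<Delta> t) ** S t)" for t
  interpret port_hamiltonian P\<^sub>1 G\<^sub>0 W\<^sub>B\<^sub>1 W\<^sub>B\<^sub>0 W\<^sub>C\<^sub>1 W\<^sub>C\<^sub>0 H H\<^sub>0 H\<^sub>0' K
  proof
    show "AE t in unit_lebesgue. H t = H\<^sub>0 t"
      using assms(11)
    proof eventually_elim
      case (elim t)
      then have "matrix_inv P\<^sub>1 ** (P\<^sub>1 ** H t) = H\<^sub>0 t" by (simp add: H\<^sub>0_def)
      then show ?case by (simp add: matrix_mul_assoc matrix_inv(2)[OF \<open>invertible P\<^sub>1\<close>])
    qed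
    show "AE t in unit_lebesgue. hermitian (H t)"
      using assms(8) by eventually_elim (simp add: positive_hermitian_def)
    show "AE t in unit_lebesgue. \<forall>v. norm (H t *v v) \<le> K * norm v"
      using B by eventually_elim (auto intro: le_K)
    \<comment> \<open>Coercivity of \<open>H\<close> comes from the essential bound of its inverse
      together with pointwise positivity.\<close>
    show "AE t in unit_lebesgue. \<forall>v. (norm v)\<^sup>2 \<le> K * (v \<bullet> (H t *v v))"
      using B' assms(8) by eventually_elim (auto intro!: positive_hermitian_coercive le_K K)
    show "(H\<^sub>0 has_vector_derivative H\<^sub>0' t) (at t within {0..1})" if "t \<in> {0..1}" for t
      unfolding H\<^sub>0_def H\<^sub>0'_def
      by (intro bounded_linear.has_vector_derivative[OF mm.bounded_linear_right]
          mm.has_vector_derivative S' Si' \<Delta>' that)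
    show "continuous_on {0..1} H\<^sub>0'"
      unfolding H\<^sub>0'_def by (intro mm.continuous_on continuous_intros cont S' Si' \<Delta>')
  qed (use assms K in auto)
  show ?thesis
    unfolding D_def A_def C_def
    using hautus_test approximately_observable[OF \<open>generates D A T\<close>[unfolded D_def A_def] \<open>exponentially_stable H T\<close>]
    by blast
qed

end
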